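(* Let $P:\mathbb{C}\to\mathbb{R}$ be smooth, subharmonic and non-harmonic, and let $\Omega=\{(z_1,z_2)\in\mathbb{C}^2:\Im(z_2)>P(z_1)\}$. Suppose that ${\rm b}\Omega$ has uniform global structure $(f(\delta),\delta_0)$, and define $Cyl_d(p_0,\delta)$ to be the image of $\Psi_{p_0,\delta}:B(0,1)\times(-1,1)\to{\rm b}\Omega$, $$\Psi_{p_0,\delta}(a,b,c)=\exp(a\delta X+b\delta Y+cf(\delta)\partial_t)(p_0),$$ where $(a,b)\in B(0,1)=\{(a,b)\in\mathbb{R}^2:a^2+b^2<1\}$ and $c\in(-1,1)$. If $\delta\ge\delta_0$, then there exist $R>r>0$ (independent of $\delta$ and $p_0$) such that $$Cyl_d(p_0,r\delta)\subset B_d(p_0,\delta)\subset Cyl_d(p_0,R\delta).$$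
   Context: ${\rm b}\Omega$ is identified with $\mathbb{C}\times\mathbb{R}$ via $(z,t+iP(z))\sim(z,t)\sim(x,y,t)$, $z=x+iy$. On ${\rm b}\Omega$ consider the real vector fields $$X=\tfrac12\partial_x+\tfrac12\partial_yP(x,y)\,\partial_t,\qquad Y=-\tfrac12\partial_y+\tfrac12\partial_xP(x,y)\,\partial_t.$$ For a vector field $V$, $\exp(V)(p_0)$ denotes the time-one point of the integral curve of $V$ starting at $p_0$. $FPWS[0,1]$: real functions $f$ on $[0,1]$ for which there are finitely many points $0=a_0<a_1<\dots<a_N<a_{N+1}=1$ such that, for each $i$, $f$ is smooth on $(a_i,a_{i+1})$ and $f|_{(a_i,a_{i+1})}$ extends continuously to $[a_i,a_{i+1}]$. The Carnot-Carathéodory metric $d(p,q)$ is the infimum of all $\delta$ for which there is a path $\gamma:[0,1]\to{\rm b}\Omega$ with $\gamma(0)=p$, $\gamma(1)=q$, $\gamma'(t)=\alpha(t)\delta X(\gamma(t))+\beta(t)\delta Y(\gamma(t))$ a.e., where $\alpha,\beta\in FPWS[0,1]$ and $|\alpha(t)|^2+|\beta(t)|^2<1$ a.e. $B_d(p,\delta)=\{q:d(p,q)<\delta\}$. $\mathscr{X}^\ast$ is the set of pairs $(\alpha,\beta)$ with $\alpha,\beta\in FPWS[0,1]$, $|\alpha(s)|^2+|\beta(s)|^2<1$, $\int_0^1\alpha=\int_0^1\beta=0$. For $z_0=x_0+iy_0$, $\delta>0$ and $(\alpha,\beta)\in\mathscr{X}^\ast$ let $\gamma_1(r)=x_0+\frac{\delta}{2}\int_0^r\alpha(s)ds$,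 $\gamma_2(r)=y_0-\frac{\delta}{2}\int_0^r\beta(s)ds$, and $$\Lambda_{z_0,\delta}(\alpha,\beta)=\int_0^1\left[\partial_yP(\gamma_1(r),\gamma_2(r))\gamma_1'(r)-\partial_xP(\gamma_1(r),\gamma_2(r))\gamma_2'(r)\right]dr.$$ For $p=(z_0,t_0)\in{\rm b}\Omega$ define $\Lambda(p,\delta)=\sup_{(\alpha,\beta)\in\mathscr{X}^\ast}|\Lambda_{z_0,\delta}(\alpha,\beta)|$. A uniform global structure (UGS) of ${\rm b}\Omega$ is a pair $(f(\delta),\delta_0)$ with $\delta_0>0$ and $f:[\delta_0,\infty)\to[0,\infty)$ such that $\Lambda(p,\delta)\approx f(\delta)$ for $\delta\ge\delta_0$ (and all $p\in{\rm b}\Omega$), i.e. each side is bounded by a constant times the other, with constants depending only on $\delta_0$.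
   Formalization: The first inclusion Cyl_d(p_0,rδ) ⊂ B_d(p_0,δ) is asserted only for those δ ≥ δ_0 with rδ ≥ δ_0, since f, and hence Cyl_d(p_0,rδ), is undefined below δ_0; r and R are still independent of δ and p_0. *)

theory Defs
  imports "HOL-Analysis.Analysis"
begin

section \<open>Smooth, harmonic and subharmonic functions on the plane\<close>

definition partial_x :: "(complex \<Rightarrow> real) \<Rightarrow> complex \<Rightarrow> real" where
  "partial_x u z = deriv (\<lambda>x. u (Complex x (Im z))) (Re z)"

definition partial_y :: "(complex \<Rightarrow> real) \<Rightarrow> complex \<Rightarrow> real" where
  "partial_y u z = deriv (\<lambda>y. u (Complex (Re z) y)) (Im z)"

text \<open>Differentiability is over the reals; \<open>u\<close> is smooth iff it and all its iterated
  partial derivatives are (Frechet) differentiable everywhere, i.e. iff it is of class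
  \<open>C\<^sup>k\<close> for every \<open>k\<close>.\<close>

fun class_C :: "nat \<Rightarrow> (complex \<Rightarrow> real) \<Rightarrow> bool" where
  "class_C 0 u \<longleftrightarrow> continuous_on UNIV u"
| "class_C (Suc k) u \<longleftrightarrow>
     (\<forall>z. u differentiable (at z)) \<and> class_C k (partial_x u) \<and> class_C k (partial_y u)"

definition smooth_plane :: "(complex \<Rightarrow> real) \<Rightarrow> bool" where
  "smooth_plane u \<longleftrightarrow> (\<forall>k. class_C k u)"

definition harmonic_plane :: "(complex \<Rightarrow> real) \<Rightarrow> bool" where
  "harmonic_plane u \<longleftrightarrow> class_C 2 u \<and>
     (\<forall>z. partial_x (partial_x u) z + partial_y (partial_y u) z = 0)"

text \<open>Sub-mean-value property over all circles. Only finite continuous functions are considered,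
  so upper semicontinuity is replaced by continuity and the integral always exists.\<close>

definition subharmonic_plane :: "(complex \<Rightarrow> real) \<Rightarrow> bool" where
  "subharmonic_plane u \<longleftrightarrow> continuous_on UNIV u \<and>
     (\<forall>z r. 0 < r \<longrightarrow>
        u z \<le> (1 / (2 * pi)) * integral {0..2 * pi} (\<lambda>\<theta>. u (z + of_real r * cis \<theta>)))"

section \<open>The model domain and its boundary\<close>

definition model_domain :: "(complex \<Rightarrow> real) \<Rightarrow> (complex \<times> complex) set" where
  "model_domain P = {q. P (fst q) < Im (snd q)}"

text \<open>All boundary objects below live on \<open>complex \<times> real\<close>, which is identified with the boundary of
  the domain through the following map.\<close>

definition boundary_point :: "(complex \<Rightarrow> real) \<Rightarrow> complex \<times> real \<Rightarrow> complex \<times> complex" where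
  "boundary_point P = (\<lambda>(z, t). (z, of_real t + \<i> * of_real (P z)))"

lemma bij_betw_boundary_point:
  assumes P: "continuous_on UNIV P"
  shows "bij_betw (boundary_point P) UNIV (frontier (model_domain P))"
proof -
  have cont: "continuous_on UNIV (\<lambda>q::complex \<times> complex. P (fst q))"
    by (rule continuous_on_compose2[OF P]) (auto intro: continuous_intros)
  have "open {q::complex \<times> complex. P (fst q) < Im (snd q)}"
    by (intro open_Collect_less cont continuous_intros)
  hence op: "open (model_domain P)"
    by (simp add: model_domain_def)
  have cl: "closed {q::complex \<times> complex. P (fst q) \<le> Im (snd q)}"
    by (intro closed_Collect_le cont continuous_intros)
  have sub: "closure (model_domain P) \<subseteq> {q. P (fst q) \<le> Im (snd q)}"
    by (rule closure_minimal[OF _ cl]) (auto simp: model_domain_def)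
  have sup: "q \<in> closure (model_domain P)" if q: "P (fst q) \<le> Im (snd q)" for q
  proof (rule closure_sequential[THEN iffD2], intro exI conjI allI)
    let ?s = "\<lambda>n. (fst q, snd q + \<i> * of_real (inverse (real (Suc n))))"
    show "?s n \<in> model_domain P" for n
    proof -
      have "0 < inverse (real (Suc n))" by simp
      with q have "P (fst q) < Im (snd q) + inverse (real (Suc n))" by linarith
      thus ?thesis by (simp add: model_domain_def del: of_nat_Suc of_real_inverse)
    qed
    have "(\<lambda>n. of_real (inverse (real (Suc n)))) \<longlonglongrightarrow> (of_real 0 :: complex)"
      by (intro tendsto_of_real LIMSEQ_inverse_real_of_nat)
    from tendsto_add[OF tendsto_const tendsto_mult[OF tendsto_const this]]
    have "(\<lambda>n. snd q + \<i> * of_real (inverse (real (Suc n)))) \<longlonglongrightarrow> snd q + \<i> * of_real 0" .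
    from tendsto_Pair[OF tendsto_const this, of "fst q"]
    show "?s \<longlonglongrightarrow> q" by simp
  qed
  have "frontier (model_domain P) = {q. Im (snd q) = P (fst q)}"
    using sub sup interior_open[OF op]
    by (force simp: frontier_def model_domain_def)
  also have "\<dots> = range (boundary_point P)"
  proof (intro equalityI subsetI)
    fix q :: "complex \<times> complex" assume "q \<in> {q. Im (snd q) = P (fst q)}"
    hence "q = boundary_point P (fst q, Re (snd q))"
      by (simp add: boundary_point_def prod_eq_iff complex_eq_iff)
    thus "q \<in> range (boundary_point P)" by blast
  qed (auto simp: boundary_point_def)
  finally have fr: "frontier (model_domain P) = range (boundary_point P)" .
  have "inj (boundary_point P)"
    by (auto simp: inj_def boundary_point_def complex_eq_iff)
  thus ?thesis by (simp add: fr bij_betw_def)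
qed

text \<open>A vector field assigns to each point its component vector with respect to
  \<open>(\<partial>\<^sub>x, \<partial>\<^sub>y, \<partial>\<^sub>t)\<close>, the first two being combined into a complex number.\<close>

type_synonym vfield = "complex \<times> real \<Rightarrow> complex \<times> real"

definition field_X :: "(complex \<Rightarrow> real) \<Rightarrow> vfield" where
  "field_X P = (\<lambda>(z, t). (Complex (1 / 2) 0, (1 / 2) * partial_y P z))"

definition field_Y :: "(complex \<Rightarrow> real) \<Rightarrow> vfield" where
  "field_Y P = (\<lambda>(z, t). (Complex 0 (- 1 / 2), (1 / 2) * partial_x P z))"

definition field_T :: vfield where
  "field_T = (\<lambda>_. (0, 1))"

definition integral_curve :: "vfield \<Rightarrow> complex \<times> real \<Rightarrow> (real \<Rightarrow> complex \<times> real) \<Rightarrow> bool" where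
  "integral_curve V p \<gamma> \<longleftrightarrow> \<gamma> 0 = p \<and>
     (\<forall>s\<in>{0..1}. (\<gamma> has_vector_derivative V (\<gamma> s)) (at s within {0..1}))"

definition exp_field :: "vfield \<Rightarrow> complex \<times> real \<Rightarrow> complex \<times> real" where
  "exp_field V p = (THE q. \<exists>\<gamma>. integral_curve V p \<gamma> \<and> \<gamma> 1 = q)"

section \<open>The Carnot--Caratheodory metric\<close>

definition smooth_on_interval :: "(real \<Rightarrow> real) \<Rightarrow> real \<Rightarrow> real \<Rightarrow> bool" where
  "smooth_on_interval g a b \<longleftrightarrow>
     (\<forall>k. \<forall>s\<in>{a<..<b}. (deriv ^^ k) g field_differentiable (at s))"

text \<open>Functions on \<open>[0,1]\<close> are total functions whose values outside \<open>[0,1]\<close> are irrelevant.\<close>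

definition FPWS :: "(real \<Rightarrow> real) set" where
  "FPWS = {g. \<exists>N (a :: nat \<Rightarrow> real). a 0 = 0 \<and> a (Suc N) = 1 \<and>
     (\<forall>i\<le>N. a i < a (Suc i) \<and> smooth_on_interval g (a i) (a (Suc i)) \<and>
        (\<exists>h. continuous_on {a i..a (Suc i)} h \<and> (\<forall>s\<in>{a i<..<a (Suc i)}. h s = g s)))}"

text \<open>Absolute continuity on \<open>[a,b]\<close>: \<open>D\<close> ranges over the finite families of nonoverlapping
  closed subintervals.\<close>

definition abs_continuous_on :: "real \<Rightarrow> real \<Rightarrow> (real \<Rightarrow> 'a::real_normed_vector) \<Rightarrow> bool" where
  "abs_continuous_on a b \<gamma> \<longleftrightarrow>
     (\<forall>\<epsilon>>0. \<exists>\<eta>>0. \<forall>D S. D division_of S \<longrightarrow> S \<subseteq> {a..b} \<longrightarrow> (\<Sum>K\<in>D. measure lborel K) < \<eta> \<longrightarrow>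
        (\<Sum>K\<in>D. norm (\<gamma> (Sup K) - \<gamma> (Inf K))) < \<epsilon>)"

text \<open>Since the differential equation is only required almost everywhere, paths have to be
  absolutely continuous; mere continuity would admit Cantor-type paths of length zero.\<close>

definition cc_admissible ::
    "(complex \<Rightarrow> real) \<Rightarrow> complex \<times> real \<Rightarrow> complex \<times> real \<Rightarrow> real \<Rightarrow> bool" where
  "cc_admissible P p q \<delta> \<longleftrightarrow>
     (\<exists>\<gamma>. \<exists>\<alpha>\<in>FPWS. \<exists>\<beta>\<in>FPWS.
        abs_continuous_on 0 1 \<gamma> \<and> \<gamma> 0 = p \<and> \<gamma> 1 = q \<and>
        (AE s in lebesgue_on {0..1}. \<bar>\<alpha> s\<bar>\<^sup>2 + \<bar>\<beta> s\<bar>\<^sup>2 < 1) \<and>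
        (AE s in lebesgue_on {0..1}.
           (\<gamma> has_vector_derivative
              (\<alpha> s * \<delta>) *\<^sub>R field_X P (\<gamma> s) + (\<beta> s * \<delta>) *\<^sub>R field_Y P (\<gamma> s))
             (at s within {0..1})))"

text \<open>The infimum is over positive \<open>\<delta>\<close>, and is \<open>\<infinity>\<close> if there is no admissible path.\<close>

definition cc_dist :: "(complex \<Rightarrow> real) \<Rightarrow> complex \<times> real \<Rightarrow> complex \<times> real \<Rightarrow> ereal" where
  "cc_dist P p q = (INF \<delta>\<in>{\<delta>. 0 < \<delta> \<and> cc_admissible P p q \<delta>}. ereal \<delta>)"

definition cc_ball :: "(complex \<Rightarrow> real) \<Rightarrow> complex \<times> real \<Rightarrow> real \<Rightarrow> (complex \<times> real) set" where
  "cc_ball P p \<delta> = {q. cc_dist P p q < ereal \<delta>}"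

section \<open>Uniform global structure\<close>

definition X_star :: "((real \<Rightarrow> real) \<times> (real \<Rightarrow> real)) set" where
  "X_star = {(\<alpha>, \<beta>). \<alpha> \<in> FPWS \<and> \<beta> \<in> FPWS \<and>
     (\<forall>s\<in>{0..1}. \<bar>\<alpha> s\<bar>\<^sup>2 + \<bar>\<beta> s\<bar>\<^sup>2 < 1) \<and>
     integral {0..1} \<alpha> = 0 \<and> integral {0..1} \<beta> = 0}"

definition loop_x :: "complex \<Rightarrow> real \<Rightarrow> (real \<Rightarrow> real) \<Rightarrow> real \<Rightarrow> real" where
  "loop_x z0 \<delta> \<alpha> r = Re z0 + \<delta> / 2 * integral {0..r} \<alpha>"

definition loop_y :: "complex \<Rightarrow> real \<Rightarrow> (real \<Rightarrow> real) \<Rightarrow> real \<Rightarrow> real" where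
  "loop_y z0 \<delta> \<beta> r = Im z0 - \<delta> / 2 * integral {0..r} \<beta>"

definition Lambda_path ::
    "(complex \<Rightarrow> real) \<Rightarrow> complex \<Rightarrow> real \<Rightarrow> (real \<Rightarrow> real) \<Rightarrow> (real \<Rightarrow> real) \<Rightarrow> real" where
  "Lambda_path P z0 \<delta> \<alpha> \<beta> = integral {0..1} (\<lambda>r.
     partial_y P (Complex (loop_x z0 \<delta> \<alpha> r) (loop_y z0 \<delta> \<beta> r)) * deriv (loop_x z0 \<delta> \<alpha>) r
     - partial_x P (Complex (loop_x z0 \<delta> \<alpha> r) (loop_y z0 \<delta> \<beta> r)) * deriv (loop_y z0 \<delta> \<beta>) r)"

text \<open>For smooth \<open>P\<close> the supremum is over a nonempty bounded set of reals, because all the loops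
  stay in a fixed disc and have bounded speed.\<close>

definition Lambda :: "(complex \<Rightarrow> real) \<Rightarrow> complex \<times> real \<Rightarrow> real \<Rightarrow> real" where
  "Lambda P p \<delta> = (SUP (\<alpha>, \<beta>)\<in>X_star. \<bar>Lambda_path P (fst p) \<delta> \<alpha> \<beta>\<bar>)"

text \<open>Only the values of \<open>f\<close> on \<open>[\<delta>\<^sub>0,\<infinity>)\<close> are constrained; this half line is its domain.\<close>

definition uniform_global_structure ::
    "(complex \<Rightarrow> real) \<Rightarrow> (real \<Rightarrow> real) \<Rightarrow> real \<Rightarrow> bool" where
  "uniform_global_structure P f \<delta>\<^sub>0 \<longleftrightarrow> 0 < \<delta>\<^sub>0 \<and> (\<forall>\<delta>\<ge>\<delta>\<^sub>0. 0 \<le> f \<delta>) \<and>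
     (\<exists>C>0. \<forall>p. \<forall>\<delta>\<ge>\<delta>\<^sub>0. Lambda P p \<delta> \<le> C * f \<delta> \<and> f \<delta> \<le> C * Lambda P p \<delta>)"

definition Psi ::
    "(complex \<Rightarrow> real) \<Rightarrow> (real \<Rightarrow> real) \<Rightarrow> complex \<times> real \<Rightarrow> real \<Rightarrow>
       (real \<times> real) \<times> real \<Rightarrow> complex \<times> real" where
  "Psi P f p0 \<delta> = (\<lambda>((a, b), c).
     exp_field (\<lambda>p. (a * \<delta>) *\<^sub>R field_X P p + (b * \<delta>) *\<^sub>R field_Y P p + (c * f \<delta>) *\<^sub>R field_T p) p0)"

definition Cyl ::
    "(complex \<Rightarrow> real) \<Rightarrow> (real \<Rightarrow> real) \<Rightarrow> complex \<times> real \<Rightarrow> real \<Rightarrow> (complex \<times> real) set" where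
  "Cyl P f p0 \<delta> = Psi P f p0 \<delta> ` ({(a, b). a\<^sup>2 + b\<^sup>2 < 1} \<times> {-1<..<1})"

end

theory Submission
  imports Defs
begin

text \<open>
  The $t$-coordinate of a curve tangent to $X$ and $Y$ is determined by its projection to the plane:
  along a horizontal curve $dt = P_y\,dx - P_x\,dy$. Hence two horizontal curves with the same
  projected endpoints differ at the end by a purely vertical displacement, which is the integral of
  that form over the loop composed of one projection and the reverse of the other. The function
  $\Lambda(p,\delta)$ is the supremum of such displacements over loops of size $\delta$, so it
  measures the height of a ball, while the width is of order $\delta$ for trivial reasons. The
  statement then reduces to three facts about the relation \<open>reach P \<delta> p q\<close> (there is a horizontal
  curve of size \<open>\<delta>\<close> from \<open>p\<close> to \<open>q\<close>).

  \<^item> Sizes add under concatenation, reversal preserves size, and vertical translations preserve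
    everything, because the coefficients of $X$ and $Y$ do not depend on $t$.
  \<^item> A vertical displacement \<open>h\<close> of size \<open>\<delta>\<close> satisfies \<open>\<bar>h\<bar> \<le> \<Lambda>(p,\<delta>)\<close>
    (\<open>abs_displacement_le_Lambda\<close>), and every \<open>h\<close> with \<open>\<bar>h\<bar> < \<Lambda>(p,\<delta>)\<close> is realised
    (\<open>reach_vertical_of_less_Lambda\<close>): shrinking the controls of a loop to zero moves its displacement
    continuously to zero, and reversing the loop changes the sign.
  \<^item> Running through a loop \<open>n\<close> times gives \<open>n * \<Lambda>(p,\<delta>) \<le> \<Lambda>(p,n\<delta>)\<close> (\<open>Lambda_superadditive\<close>).
    This growth is what absorbs the constant in \<open>\<Lambda> \<approx> f\<close>.

  Let \<open>C\<close> be the constant of the uniform global structure and \<open>n > C\<close>. A point of the cylinder of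
  size \<open>e\<close> at \<open>p\<close> is the end of a straight segment of size \<open>e\<close> followed by a vertical displacement
  below \<open>f(e) \<le> n\<Lambda>(e)\<close> in absolute value, which \<open>n\<close> loops of size \<open>e\<close> achieve; so
  \<open>(n + 1) * e < \<delta>\<close> suffices for the first inclusion. Conversely, given a curve of size \<open>\<delta>\<close> from \<open>p\<close>
  to \<open>q\<close>, going back along the straight segment costs at most \<open>2\<delta>\<close>. The resulting loop has size \<open>3\<delta>\<close>
  and closes up to a vertical error \<open>D\<close> with \<open>\<bar>D\<bar> \<le> \<Lambda>(p,3\<delta>) \<le> \<Lambda>(p,3n\<delta>)/n \<le> (C/n) f(3n\<delta>)\<close>,
  so \<open>q\<close> lies in the cylinder of size \<open>3n\<delta>\<close>.

  Admissible paths of the metric are merely absolutely continuous and solve their equation almost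
  everywhere, whereas the argument uses curves that are differentiable off a finite set. The two
  notions agree up to an arbitrarily small change of size (\<open>reach_imp_cc_admissible\<close>,
  \<open>cc_admissible_imp_reach\<close>); the nontrivial direction is that an absolutely continuous function
  with zero derivative almost everywhere is constant.
\<close>

section \<open>Piecewise smooth functions and their breakpoints\<close>

text \<open>The condition on one piece of a function in \<open>FPWS\<close>.\<close>

definition tame_on :: "(real \<Rightarrow> real) \<Rightarrow> real \<Rightarrow> real \<Rightarrow> bool" where
  "tame_on g a b \<longleftrightarrow> smooth_on_interval g a b \<and>
     (\<exists>h. continuous_on {a..b} h \<and> (\<forall>s\<in>{a<..<b}. h s = g s))"

lemma tame_on_subinterval:
  assumes "tame_on g a b" "a \<le> u" "v \<le> b"
  shows "tame_on g u v"
proof -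
  obtain h where h: "continuous_on {a..b} h" "\<forall>s\<in>{a<..<b}. h s = g s"
    using assms(1) by (auto simp: tame_on_def)
  have "continuous_on {u..v} h" by (rule continuous_on_subset[OF h(1)]) (use assms in auto)
  moreover have "\<forall>s\<in>{u<..<v}. h s = g s" using h(2) assms by auto
  moreover have "smooth_on_interval g u v"
    using assms unfolding tame_on_def smooth_on_interval_def by auto
  ultimately show ?thesis by (auto simp: tame_on_def)
qed

text \<open>The chain rule \<open>(deriv ^^ n) f s = c * k ^ n * (deriv ^^ n) g (k * s + d)\<close> is proved on
  the whole open set at once, since each step differentiates the identity obtained so far and
  therefore needs it in a neighbourhood.\<close>

lemma higher_deriv_affine:
  fixes f g :: "real \<Rightarrow> real"
  assumes g: "\<And>n s. s \<in> I' \<Longrightarrow> (deriv ^^ n) g field_differentiable (at s)"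
    and I: "open I" "\<And>s. s \<in> I \<Longrightarrow> k * s + d \<in> I'"
    and f: "\<And>s. s \<in> I \<Longrightarrow> f s = c * g (k * s + d)"
    and s: "s \<in> I"
  shows "(deriv ^^ n) f s = c * k ^ n * (deriv ^^ n) g (k * s + d)"
    and "(deriv ^^ n) f field_differentiable (at s)"
proof -
  have der: "((deriv ^^ n) f has_field_derivative c * k ^ Suc n * (deriv ^^ Suc n) g (k * s + d)) (at s)"
    if eq: "\<And>s. s \<in> I \<Longrightarrow> (deriv ^^ n) f s = c * k ^ n * (deriv ^^ n) g (k * s + d)"
      and s: "s \<in> I" for n s
  proof -
    have "((deriv ^^ n) g has_field_derivative (deriv ^^ Suc n) g (k * s + d)) (at (k * s + d))"
      using g[OF I(2)[OF s], of n] by (simp add: field_differentiable_derivI)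
    moreover have "((\<lambda>s. k * s + d) has_field_derivative k) (at s)"
      by (auto intro!: derivative_eq_intros)
    ultimately have "((\<lambda>s. (deriv ^^ n) g (k * s + d)) has_field_derivative
            (deriv ^^ Suc n) g (k * s + d) * k) (at s)"
      by (rule DERIV_chain2)
    from DERIV_cmult[OF this, of "c * k ^ n"]
    have "((\<lambda>s. c * k ^ n * (deriv ^^ n) g (k * s + d)) has_field_derivative
            c * k ^ Suc n * (deriv ^^ Suc n) g (k * s + d)) (at s)"
      by (simp add: mult_ac)
    then show ?thesis
      by (rule has_field_derivative_transform_within_open[OF _ I(1) s]) (simp add: eq)
  qed
  have eq: "(deriv ^^ n) f s = c * k ^ n * (deriv ^^ n) g (k * s + d)" if "s \<in> I" for n s
    using that
  proof (induction n arbitrary: s)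
    case 0 then show ?case by (simp add: f)
  next
    case (Suc n)
    from DERIV_imp_deriv[OF der[OF Suc.IH Suc.prems]] show ?case by simp
  qed
  show "(deriv ^^ n) f s = c * k ^ n * (deriv ^^ n) g (k * s + d)" by (rule eq[OF s])
  show "(deriv ^^ n) f field_differentiable (at s)"
    using der[OF eq s] by (auto simp: field_differentiable_def)
qed

lemma tame_on_affine:
  assumes g: "tame_on g u' v'"
    and op: "\<And>s. s \<in> {u<..<v} \<Longrightarrow> k * s + d \<in> {u'<..<v'}"
    and cl: "\<And>s. s \<in> {u..v} \<Longrightarrow> k * s + d \<in> {u'..v'}"
    and f: "\<And>s. s \<in> {u<..<v} \<Longrightarrow> f s = c * g (k * s + d)"
  shows "tame_on f u v"
proof -
  obtain h where h: "continuous_on {u'..v'} h" "\<forall>s\<in>{u'<..<v'}. h s = g s"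
    using g by (auto simp: tame_on_def)
  have "continuous_on {u..v} (\<lambda>s. c * h (k * s + d))"
    by (intro continuous_intros continuous_on_compose2[OF h(1)]) (use cl in auto)
  moreover have "\<forall>s\<in>{u<..<v}. c * h (k * s + d) = f s"
    using h(2) op f by auto
  moreover have "smooth_on_interval f u v"
    unfolding smooth_on_interval_def
    using higher_deriv_affine(2)[where I = "{u<..<v}" and I' = "{u'<..<v'}" and g = g, OF _ _ op f] g
    by (auto simp: tame_on_def smooth_on_interval_def)
  ultimately show ?thesis by (auto simp: tame_on_def)
qed

text \<open>Partitions are awkward to merge and to transform. A finite set of forbidden points is
  not: it may be enlarged freely, so common breakpoints of several functions are just unions.
  All closure properties below are obtained through this description.\<close>

lemma FPWS_iff_breakpoints:
  "g \<in> FPWS \<longleftrightarrow> (\<exists>F. finite F \<and>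
     (\<forall>u v. 0 \<le> u \<longrightarrow> u < v \<longrightarrow> v \<le> 1 \<longrightarrow> {u<..<v} \<inter> F = {} \<longrightarrow> tame_on g u v))"
  (is "_ \<longleftrightarrow> (\<exists>F. ?Q F)")
proof
  assume "g \<in> FPWS"
  then obtain N and a :: "nat \<Rightarrow> real" where a: "a 0 = 0" "a (Suc N) = 1"
    and step: "\<And>i. i \<le> N \<Longrightarrow> a i < a (Suc i) \<and> tame_on g (a i) (a (Suc i))"
    by (auto simp: FPWS_def tame_on_def)
  have "tame_on g u v" if uv: "0 \<le> u" "u < v" "v \<le> 1" "{u<..<v} \<inter> a ` {..Suc N} = {}" for u v
  proof -
    define I where "I = {i. i \<le> N \<and> a i \<le> u}"
    have I: "finite I" "0 \<in> I" using a uv by (auto simp: I_def)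
    define i where "i = Max I"
    have i: "i \<in> I" unfolding i_def using I by (intro Max_in) auto
    have "u < a (Suc i)"
    proof (rule ccontr)
      assume n: "\<not> u < a (Suc i)"
      show False
      proof (cases "i = N")
        case True then show False using n a uv by auto
      next
        case False
        then have "Suc i \<in> I" using i n by (auto simp: I_def)
        from Max_ge[OF I(1) this] show False by (simp add: i_def)
      qed
    qed
    moreover have "a (Suc i) \<in> a ` {..Suc N}" using i by (auto simp: I_def)
    ultimately have "v \<le> a (Suc i)" using uv(4) by force
    then show ?thesis using step[of i] i by (auto simp: I_def intro: tame_on_subinterval)
  qed
  then have "?Q (a ` {..Suc N})" by auto
  then show "\<exists>F. ?Q F" ..
next
  assume "\<exists>F. ?Q F"
  then obtain F where F: "finite F"
    and tame: "\<And>u v. 0 \<le> u \<Longrightarrow> u < v \<Longrightarrow> v \<le> 1 \<Longrightarrow> {u<..<v} \<inter> F = {} \<Longrightarrow> tame_on g u v" by blast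
  define A where "A = insert 0 (insert 1 (F \<inter> {0<..<1}))"
  define xs where "xs = sorted_list_of_set A"
  have A: "finite A" "A \<subseteq> {0..1}" using F by (auto simp: A_def)
  have xs: "set xs = A" "sorted_wrt (<) xs" "length xs = card A"
    unfolding xs_def using A by auto
  have "card {0, 1::real} \<le> card A" by (rule card_mono[OF A(1)]) (auto simp: A_def)
  then have len: "2 \<le> length xs" by (simp add: xs)
  define N where "N = length xs - 2"
  have N: "length xs = Suc (Suc N)" using len by (simp add: N_def)
  have mono: "i < j \<Longrightarrow> j \<le> Suc N \<Longrightarrow> xs ! i < xs ! j" for i j
    using sorted_wrt_nth_less[OF xs(2), of i j] by (simp add: N)
  have inA: "xs ! i \<in> A" if "i \<le> Suc N" for i
    using that xs(1) N nth_mem[of i xs] by auto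
  have idx: "\<exists>i\<le>Suc N. xs ! i = x" if "x \<in> A" for x
    using that xs(1) N by (auto simp: in_set_conv_nth less_Suc_eq_le)
  have "xs ! 0 = 0"
  proof -
    obtain i where "i \<le> Suc N" "xs ! i = 0" using idx[of 0] by (auto simp: A_def)
    then show ?thesis using mono[of 0 i] inA[of 0] A(2) by (cases "i = 0") force+
  qed
  moreover have "xs ! Suc N = 1"
  proof -
    obtain i where "i \<le> Suc N" "xs ! i = 1" using idx[of 1] by (auto simp: A_def)
    then show ?thesis using mono[of i "Suc N"] inA[of "Suc N"] A(2) by (cases "i = Suc N") force+
  qed
  moreover have "xs ! i < xs ! Suc i \<and> tame_on g (xs ! i) (xs ! Suc i)" if i: "i \<le> N" for i
  proof
    show lt: "xs ! i < xs ! Suc i" using mono i by auto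
    have le: "0 \<le> xs ! i" "xs ! Suc i \<le> 1" using inA[of i] inA[of "Suc i"] i A(2) by auto
    have "{xs ! i<..<xs ! Suc i} \<inter> F = {}"
    proof (rule ccontr)
      assume "\<not> ?thesis"
      then obtain x where x: "x \<in> F" "xs ! i < x" "x < xs ! Suc i" by auto
      then have "x \<in> A" using le by (auto simp: A_def)
      then obtain j where j: "j \<le> Suc N" "xs ! j = x" using idx by auto
      consider "j < i" | "j = i" | "j = Suc i" | "Suc i < j" by linarith
      then show False
        using mono[of j i] mono[of "Suc i" j] x j i by cases auto
    qed
    then show "tame_on g (xs ! i) (xs ! Suc i)" using tame le lt by auto
  qed
  ultimately show "g \<in> FPWS" unfolding FPWS_def tame_on_def
    by (intro CollectI exI[of _ N] exI[of _ "\<lambda>i. xs ! i"]) auto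
qed

lemma FPWS_E:
  assumes "g \<in> FPWS"
  obtains F where "finite F"
    "\<And>u v. 0 \<le> u \<Longrightarrow> u < v \<Longrightarrow> v \<le> 1 \<Longrightarrow> {u<..<v} \<inter> F = {} \<Longrightarrow> tame_on g u v"
  using assms unfolding FPWS_iff_breakpoints by blast

lemma FPWS_I:
  assumes "finite F"
    "\<And>u v. 0 \<le> u \<Longrightarrow> u < v \<Longrightarrow> v \<le> 1 \<Longrightarrow> {u<..<v} \<inter> F = {} \<Longrightarrow> tame_on g u v"
  shows "g \<in> FPWS"
  using assms unfolding FPWS_iff_breakpoints by blast

lemma FPWS_scale_change_finite:
  assumes g: "g \<in> FPWS" and E: "finite E" "\<And>s. s \<notin> E \<Longrightarrow> f s = c * g s"
  shows "f \<in> FPWS"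
proof -
  obtain F where F: "finite F"
    "\<And>u v. 0 \<le> u \<Longrightarrow> u < v \<Longrightarrow> v \<le> 1 \<Longrightarrow> {u<..<v} \<inter> F = {} \<Longrightarrow> tame_on g u v"
    using FPWS_E[OF g] by blast
  show ?thesis
  proof (rule FPWS_I[of "F \<union> E"])
    fix u v :: real assume uv: "0 \<le> u" "u < v" "v \<le> 1" "{u<..<v} \<inter> (F \<union> E) = {}"
    show "tame_on f u v"
      by (rule tame_on_affine[of g u v _ _ 1 0 _ c]) (use F(2)[of u v] uv E in auto)
  qed (use F E in auto)
qed

lemma FPWS_cmult: "g \<in> FPWS \<Longrightarrow> (\<lambda>s. c * g s) \<in> FPWS"
  by (rule FPWS_scale_change_finite[of g "{}"]) auto

lemma FPWS_const: "(\<lambda>_. c) \<in> FPWS"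
proof (rule FPWS_I[of "{}"])
  fix u v :: real
  have "(deriv ^^ n) (\<lambda>_. c) = (\<lambda>_. if n = 0 then c else 0)" for n
    by (induction n) auto
  then show "tame_on (\<lambda>_. c) u v"
    by (auto simp: tame_on_def smooth_on_interval_def intro: exI[of _ "\<lambda>_. c"])
qed auto

lemma FPWS_reverse:
  assumes g: "g \<in> FPWS"
  shows "(\<lambda>s. - g (1 - s)) \<in> FPWS"
proof -
  obtain F where F: "finite F"
    "\<And>u v. 0 \<le> u \<Longrightarrow> u < v \<Longrightarrow> v \<le> 1 \<Longrightarrow> {u<..<v} \<inter> F = {} \<Longrightarrow> tame_on g u v"
    using FPWS_E[OF g] by blast
  show ?thesis
  proof (rule FPWS_I[of "(\<lambda>s. 1 - s) ` F"])
    fix u v :: real assume uv: "0 \<le> u" "u < v" "v \<le> 1" "{u<..<v} \<inter> (\<lambda>s. 1 - s) ` F = {}"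
    have "x \<notin> F" if "x \<in> {1 - v<..<1 - u}" for x
    proof
      assume "x \<in> F"
      then have "1 - x \<in> (\<lambda>s. 1 - s) ` F" by (rule imageI)
      moreover have "1 - x \<in> {u<..<v}" using that by auto
      ultimately show False using uv by blast
    qed
    then have "tame_on g (1 - v) (1 - u)" using uv by (intro F(2)) auto
    then show "tame_on (\<lambda>s. - g (1 - s)) u v"
      by (rule tame_on_affine[where k = "-1" and d = 1 and c = "-1"]) auto
  qed (use F in auto)
qed

text \<open>The controls of a concatenation: the first curve is run on \<open>[0,m]\<close>, the second on \<open>[m,1]\<close>.\<close>

lemma FPWS_append:
  assumes g1: "g1 \<in> FPWS" and g2: "g2 \<in> FPWS" and m: "0 < m" "m < 1"
  shows "(\<lambda>s. if s < m then g1 (s / m) else g2 ((s - m) / (1 - m))) \<in> FPWS" (is "?g \<in> _")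
proof -
  obtain F1 where F1: "finite F1"
    "\<And>u v. 0 \<le> u \<Longrightarrow> u < v \<Longrightarrow> v \<le> 1 \<Longrightarrow> {u<..<v} \<inter> F1 = {} \<Longrightarrow> tame_on g1 u v"
    using FPWS_E[OF g1] by blast
  obtain F2 where F2: "finite F2"
    "\<And>u v. 0 \<le> u \<Longrightarrow> u < v \<Longrightarrow> v \<le> 1 \<Longrightarrow> {u<..<v} \<inter> F2 = {} \<Longrightarrow> tame_on g2 u v"
    using FPWS_E[OF g2] by blast
  let ?F1 = "(\<lambda>s. m * s) ` F1" and ?F2 = "(\<lambda>s. m + (1 - m) * s) ` F2"
  show ?thesis
  proof (rule FPWS_I[of "insert m (?F1 \<union> ?F2)"])
    fix u v :: real
    assume uv: "0 \<le> u" "u < v" "v \<le> 1" "{u<..<v} \<inter> insert m (?F1 \<union> ?F2) = {}"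
    consider "v \<le> m" | "m \<le> u" using uv by force
    then show "tame_on ?g u v"
    proof cases
      case 1
      have "x \<notin> F1" if "x \<in> {u / m<..<v / m}" for x
      proof
        assume "x \<in> F1"
        then have "m * x \<in> ?F1" by auto
        moreover have "m * x \<in> {u<..<v}"
          using that m by (simp add: pos_divide_less_eq pos_less_divide_eq algebra_simps)
        ultimately show False using uv by auto
      qed
      then have "tame_on g1 (u / m) (v / m)"
        using uv m 1 by (intro F1(2)) (auto intro: divide_strict_right_mono)
      then show ?thesis
        by (rule tame_on_affine[where k = "1 / m" and d = 0 and c = 1])
           (use m 1 in \<open>auto intro: divide_strict_right_mono divide_right_mono\<close>)
    next
      case 2
      have "x \<notin> F2" if "x \<in> {(u - m) / (1 - m)<..<(v - m) / (1 - m)}" for x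
      proof
        assume "x \<in> F2"
        then have "m + (1 - m) * x \<in> ?F2" by auto
        moreover have "m + (1 - m) * x \<in> {u<..<v}"
          using that m by (simp add: pos_divide_less_eq pos_less_divide_eq algebra_simps)
        ultimately show False using uv by auto
      qed
      moreover have "0 \<le> (u - m) / (1 - m)" "(u - m) / (1 - m) < (v - m) / (1 - m)" "(v - m) / (1 - m) \<le> 1"
        using uv m 2 by (auto intro: divide_strict_right_mono)
      ultimately have "tame_on g2 ((u - m) / (1 - m)) ((v - m) / (1 - m))"
        by (intro F2(2)) auto
      have aff: "1 / (1 - m) * s + - m / (1 - m) = (s - m) / (1 - m)" for s
        by (simp add: diff_divide_distrib)
      show ?thesis
      proof (rule tame_on_affine[OF \<open>tame_on g2 _ _\<close>, where k = "1 / (1 - m)" and d = "- m / (1 - m)" and c = 1],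
          unfold aff)
        fix s assume "s \<in> {u<..<v}"
        then show "(s - m) / (1 - m) \<in> {(u - m) / (1 - m)<..<(v - m) / (1 - m)}"
          using m by (auto intro: divide_strict_right_mono)
        show "?g s = 1 * g2 ((s - m) / (1 - m))" using \<open>s \<in> {u<..<v}\<close> 2 by auto
      next
        fix s assume "s \<in> {u..v}"
        then show "(s - m) / (1 - m) \<in> {(u - m) / (1 - m)..(v - m) / (1 - m)}"
          using m by (auto intro: divide_right_mono)
      qed
    qed
  qed (use F1 F2 in auto)
qed

text \<open>Including the endpoints among the exceptional points makes the remaining ones interior.\<close>

lemma FPWS_isCont:
  assumes "g \<in> FPWS"
  obtains F where "finite F" "0 \<in> F" "1 \<in> F" "\<And>s. s \<in> {0..1} - F \<Longrightarrow> isCont g s"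
proof -
  obtain F where F: "finite F"
    "\<And>u v. 0 \<le> u \<Longrightarrow> u < v \<Longrightarrow> v \<le> 1 \<Longrightarrow> {u<..<v} \<inter> F = {} \<Longrightarrow> tame_on g u v"
    using FPWS_E[OF assms] by blast
  have "isCont g s" if s: "s \<in> {0..1} - (insert 0 (insert 1 F))" for s
  proof -
    have "open ({0<..<1} - F)" using F(1) by (simp add: finite_imp_closed open_Diff)
    moreover have "s \<in> {0<..<1} - F" using s by auto
    ultimately obtain e where e: "0 < e" "cball s e \<subseteq> {0<..<1} - F"
      using open_contains_cball_eq by blast
    have "s - e \<in> cball s e" "s + e \<in> cball s e" using e by (auto simp: dist_real_def)
    then have ends: "s - e \<in> {0<..<1}" "s + e \<in> {0<..<1}" using e(2) by blast+
    have "{s - e<..<s + e} \<subseteq> cball s e" by (auto simp: dist_real_def)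
    then have avoid: "{s - e<..<s + e} \<inter> F = {}" using e(2) by blast
    have "tame_on g (s - e) (s + e)"
      by (rule F(2)[OF _ _ _ avoid]) (use e(1) ends in auto)
    moreover have "s \<in> {s - e<..<s + e}" using e(1) by simp
    ultimately have "(deriv ^^ 0) g field_differentiable (at s)"
      unfolding tame_on_def smooth_on_interval_def by blast
    then show ?thesis by (simp add: field_differentiable_imp_continuous_at)
  qed
  then show thesis using F(1) by (intro that[of "insert 0 (insert 1 F)"]) auto
qed

section \<open>Absolute continuity and vanishing derivatives\<close>

lemma abs_continuous_on_diff:
  assumes "abs_continuous_on a b f" "abs_continuous_on a b g"
  shows "abs_continuous_on a b (\<lambda>s. f s - g s)"
  unfolding abs_continuous_on_def
proof (intro allI impI)
  fix e :: real assume "0 < e"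
  then have e2: "0 < e / 2" by simp
  obtain \<eta>1 where \<eta>1: "\<eta>1 > 0" "\<And>D S. D division_of S \<Longrightarrow> S \<subseteq> {a..b} \<Longrightarrow>
      (\<Sum>K\<in>D. measure lborel K) < \<eta>1 \<Longrightarrow> (\<Sum>K\<in>D. norm (f (Sup K) - f (Inf K))) < e / 2"
    using assms(1) e2 unfolding abs_continuous_on_def by meson
  obtain \<eta>2 where \<eta>2: "\<eta>2 > 0" "\<And>D S. D division_of S \<Longrightarrow> S \<subseteq> {a..b} \<Longrightarrow>
      (\<Sum>K\<in>D. measure lborel K) < \<eta>2 \<Longrightarrow> (\<Sum>K\<in>D. norm (g (Sup K) - g (Inf K))) < e / 2"
    using assms(2) e2 unfolding abs_continuous_on_def by meson
  have "(\<Sum>K\<in>D. norm ((f (Sup K) - g (Sup K)) - (f (Inf K) - g (Inf K)))) < e"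
    if D: "D division_of S" "S \<subseteq> {a..b}" "(\<Sum>K\<in>D. measure lborel K) < min \<eta>1 \<eta>2" for D S
  proof -
    have "(\<Sum>K\<in>D. norm ((f (Sup K) - g (Sup K)) - (f (Inf K) - g (Inf K))))
        \<le> (\<Sum>K\<in>D. norm (f (Sup K) - f (Inf K)) + norm (g (Sup K) - g (Inf K)))"
    proof (rule sum_mono)
      fix K
      show "norm ((f (Sup K) - g (Sup K)) - (f (Inf K) - g (Inf K)))
          \<le> norm (f (Sup K) - f (Inf K)) + norm (g (Sup K) - g (Inf K))"
        using norm_triangle_ineq4[of "f (Sup K) - f (Inf K)" "g (Sup K) - g (Inf K)"]
        by (simp add: algebra_simps)
    qed
    also have "\<dots> < e / 2 + e / 2"
      unfolding sum.distrib using \<eta>1(2)[OF D(1,2)] \<eta>2(2)[OF D(1,2)] D(3) by (intro add_strict_mono) auto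
    finally show ?thesis by simp
  qed
  then show "\<exists>\<eta>>0. \<forall>D S. D division_of S \<longrightarrow> S \<subseteq> {a..b} \<longrightarrow> (\<Sum>K\<in>D. measure lborel K) < \<eta> \<longrightarrow>
      (\<Sum>K\<in>D. norm ((f (Sup K) - g (Sup K)) - (f (Inf K) - g (Inf K)))) < e"
    using \<eta>1(1) \<eta>2(1) by (intro exI[of _ "min \<eta>1 \<eta>2"] conjI allI impI) simp_all
qed

text \<open>This passes absolute continuity to the components of a curve.\<close>

lemma abs_continuous_on_dominated:
  assumes f: "abs_continuous_on a b f"
    and le: "\<And>u v. norm (g v - g u) \<le> norm (f v - f u)"
  shows "abs_continuous_on a b g"
  unfolding abs_continuous_on_def
proof (intro allI impI)
  fix e :: real assume "0 < e"
  then obtain \<eta> where \<eta>: "\<eta> > 0" "\<And>D S. D division_of S \<Longrightarrow> S \<subseteq> {a..b} \<Longrightarrow>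
      (\<Sum>K\<in>D. measure lborel K) < \<eta> \<Longrightarrow> (\<Sum>K\<in>D. norm (f (Sup K) - f (Inf K))) < e"
    using f unfolding abs_continuous_on_def by meson
  have "(\<Sum>K\<in>D. norm (g (Sup K) - g (Inf K))) < e"
    if "D division_of S" "S \<subseteq> {a..b}" "(\<Sum>K\<in>D. measure lborel K) < \<eta>" for D S
    using \<eta>(2)[OF that] by (rule order.strict_trans1[rotated]) (intro sum_mono le)
  then show "\<exists>\<eta>>0. \<forall>D S. D division_of S \<longrightarrow> S \<subseteq> {a..b} \<longrightarrow> (\<Sum>K\<in>D. measure lborel K) < \<eta> \<longrightarrow>
      (\<Sum>K\<in>D. norm (g (Sup K) - g (Inf K))) < e"
    using \<eta>(1) by auto
qed

lemma Lipschitz_imp_abs_continuous_on: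
  assumes "\<And>u v. a \<le> u \<Longrightarrow> u \<le> v \<Longrightarrow> v \<le> b \<Longrightarrow> norm (f v - f u) \<le> L * (v - u)"
  shows "abs_continuous_on a b f"
  unfolding abs_continuous_on_def
proof (intro allI impI)
  fix e :: real assume e: "0 < e"
  have "(\<Sum>K\<in>D. norm (f (Sup K) - f (Inf K))) < e"
    if D: "D division_of S" "S \<subseteq> {a..b}" "(\<Sum>K\<in>D. measure lborel K) < e / (\<bar>L\<bar> + 1)" for D S
  proof -
    have "(\<Sum>K\<in>D. norm (f (Sup K) - f (Inf K))) \<le> (\<Sum>K\<in>D. (\<bar>L\<bar> + 1) * measure lborel K)"
    proof (rule sum_mono)
      fix K assume K: "K \<in> D"
      obtain u v where uv: "K = {u..v}" using division_ofD(4)[OF D(1) K] by auto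
      have "u \<le> v" using division_ofD(3)[OF D(1) K] uv by auto
      moreover have "{u..v} \<subseteq> {a..b}" using division_ofD(2)[OF D(1) K] D(2) unfolding uv by (rule subset_trans)
      ultimately have uv': "a \<le> u" "u \<le> v" "v \<le> b" by simp_all
      have "norm (f v - f u) \<le> L * (v - u)" using assms uv' by auto
      also have "\<dots> \<le> (\<bar>L\<bar> + 1) * (v - u)" using uv' by (intro mult_right_mono) auto
      finally show "norm (f (Sup K) - f (Inf K)) \<le> (\<bar>L\<bar> + 1) * measure lborel K"
        using uv' by (simp add: uv)
    qed
    also have "\<dots> < e"
      using D(3) unfolding sum_distrib_left[symmetric]
      by (simp add: pos_less_divide_eq mult.commute add_nonneg_pos)
    finally show ?thesis .
  qed
  then show "\<exists>\<eta>>0. \<forall>D S. D division_of S \<longrightarrow> S \<subseteq> {a..b} \<longrightarrow> (\<Sum>K\<in>D. measure lborel K) < \<eta> \<longrightarrow>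
      (\<Sum>K\<in>D. norm (f (Sup K) - f (Inf K))) < e"
    using e by (intro exI[of _ "e / (\<bar>L\<bar> + 1)"] conjI allI impI) (simp_all add: add_nonneg_pos)
qed

text \<open>Choose a tagged division fine for the following gauge. At tags outside the null set
  the vanishing derivative makes the increment over an interval at most \<open>e\<close> times its length. Tags in
  the null set get intervals inside an open set of small measure, and absolute continuity bounds the
  sum of their increments by \<open>e\<close>.\<close>

lemma abs_continuous_zero_derivative_imp_eq:
  fixes f :: "real \<Rightarrow> 'a::real_normed_vector"
  assumes ac: "abs_continuous_on a b f" and N: "negligible N"
    and der: "\<And>s. s \<in> {a..b} - N \<Longrightarrow> (f has_vector_derivative 0) (at s within {a..b})"
    and t: "t \<in> {a..b}"
  shows "f t = f a"
proof -
  have "norm (f t - f a) \<le> e * (1 + (t - a))" if e: "0 < e" for e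
  proof -
    obtain \<eta> where \<eta>: "\<eta> > 0" "\<And>D S. D division_of S \<Longrightarrow> S \<subseteq> {a..b} \<Longrightarrow>
        (\<Sum>K\<in>D. measure lborel K) < \<eta> \<Longrightarrow> (\<Sum>K\<in>D. norm (f (Sup K) - f (Inf K))) < e"
      using ac e unfolding abs_continuous_on_def by meson
    have N0: "N \<in> null_sets lebesgue" using N by (simp add: negligible_iff_null_sets)
    then have NL: "N \<in> sets lebesgue" by auto
    obtain U where U: "open U" "N \<subseteq> U" "U - N \<in> lmeasurable" "emeasure lebesgue (U - N) < ennreal \<eta>"
      using sets_lebesgue_outer_open[OF NL \<eta>(1)] by blast
    have "emeasure lebesgue U = emeasure lebesgue (U - N)"
      using emeasure_Diff_null_set[OF N0, of U] U(1) by auto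
    then have Um: "emeasure lebesgue U < ennreal \<eta>" using U(4) by simp
    then have UL: "U \<in> lmeasurable"
      using U(1) by (auto simp: fmeasurable_def less_top[symmetric] top_unique dest: less_trans)
    have "measure lebesgue U < \<eta>"
      using Um UL \<eta>(1) by (simp add: emeasure_eq_measure2 ennreal_less_iff)
    have "\<exists>d>0. \<forall>y\<in>{a..b}. \<bar>y - s\<bar> < d \<longrightarrow> norm (f y - f s) \<le> e * \<bar>y - s\<bar>"
      if "s \<in> {a..b} - N" for s
      using der[OF that] e
      unfolding has_vector_derivative_def has_derivative_within_alt by fastforce
    then obtain d where d: "\<And>s. s \<in> {a..b} - N \<Longrightarrow> d s > 0"
      "\<And>s y. s \<in> {a..b} - N \<Longrightarrow> y \<in> {a..b} \<Longrightarrow> \<bar>y - s\<bar> < d s \<Longrightarrow> norm (f y - f s) \<le> e * \<bar>y - s\<bar>"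
      by metis
    \<comment> \<open>Tags lie in the interval, so the ball outside it is arbitrary.\<close>
    define G where "G s = (if s \<in> N then U else if s \<in> {a..b} then ball s (d s) else ball s 1)" for s
    have "gauge G"
      using U d(1) by (auto simp: gauge_def G_def)
    then obtain p where p: "p tagged_division_of {a..t}" "G fine p"
      using fine_division_exists_real by blast
    define p1 where "p1 = {(x, K) \<in> p. x \<in> N}"
    \<comment> \<open>The value at the empty set is set to zero: degenerate intervals must contribute nothing when the
      sum over tagged intervals is turned into a sum over intervals.\<close>
    define \<phi> where "\<phi> K = (if K = {} then 0 else norm (f (Sup K) - f (Inf K)))" for K
    have finp: "finite p" and p1: "p1 \<subseteq> p" using p(1) by (auto simp: p1_def)
    have Kp: "\<exists>u v. K = {u..v} \<and> a \<le> u \<and> u \<le> x \<and> x \<le> v \<and> v \<le> t" if "(x, K) \<in> p" for x K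
      using tagged_division_ofD(2,3,4)[OF p(1) that] by force
    have part: "p1 tagged_partial_division_of {a..t}"
      using p(1) p1 by (meson tagged_division_of_def tagged_partial_division_subset)
    note tag = tagged_partial_division_of_Union_self[OF part]
    have div: "snd ` p1 division_of \<Union>(snd ` p1)"
      using division_of_tagged_division[OF tag] .
    have sub: "\<Union>(snd ` p1) \<subseteq> {a..b}" using Kp t by (force simp: p1_def)
    have "\<Union>(snd ` p1) \<subseteq> U" using p(2) by (fastforce simp: p1_def fine_def G_def)
    have "(\<Sum>K\<in>snd ` p1. measure lborel K) = (\<Sum>K\<in>snd ` p1. measure lebesgue K)"
      using division_ofD(4)[OF div] by (intro sum.cong) force+
    also have "\<dots> = measure lebesgue (\<Union>(snd ` p1))" by (rule content_division[OF div])
    also have "\<dots> \<le> measure lebesgue U"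
      using \<open>\<Union>(snd ` p1) \<subseteq> U\<close> lmeasurable_division[OF div] UL
      by (intro measure_mono_fmeasurable) auto
    also have "\<dots> < \<eta>" by fact
    finally have "(\<Sum>K\<in>snd ` p1. norm (f (Sup K) - f (Inf K))) < e" by (rule \<eta>(2)[OF div sub])
    moreover have "(\<Sum>K\<in>snd ` p1. norm (f (Sup K) - f (Inf K))) = (\<Sum>K\<in>snd ` p1. \<phi> K)"
      using division_ofD(3)[OF div] by (intro sum.cong) (auto simp: \<phi>_def)
    ultimately have "(\<Sum>K\<in>snd ` p1. \<phi> K) < e" by simp
    moreover have "(\<Sum>(x, K)\<in>p1. \<phi> K) = (\<Sum>K\<in>snd ` p1. \<phi> K)"
    proof (rule sum.over_tagged_division_lemma[OF tag])
      fix u v :: real assume "box u v = {}"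
      then have "v \<le> u" by simp
      then show "\<phi> (cbox u v) = 0" by (cases "u = v") (auto simp: \<phi>_def)
    qed
    ultimately have bad: "(\<Sum>(x, K)\<in>p1. \<phi> K) < e" by simp
    have "(\<Sum>(x, K)\<in>p - p1. \<phi> K) \<le> (\<Sum>(x, K)\<in>p - p1. e * measure lborel K)"
    proof (rule sum_mono, clarify)
      fix x K assume xK: "(x, K) \<in> p" "(x, K) \<notin> p1"
      then have "x \<notin> N" by (simp add: p1_def)
      obtain u v where uv: "K = {u..v}" "a \<le> u" "u \<le> x" "x \<le> v" "v \<le> t"
        using Kp[OF xK(1)] by blast
      have xab: "x \<in> {a..b} - N" using \<open>x \<notin> N\<close> uv t by auto
      have "K \<subseteq> G x" using p(2) xK by (auto simp: fine_def)
      then have "K \<subseteq> ball x (d x)" using xab by (simp add: G_def)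
      moreover have "u \<in> K" "v \<in> K" using uv by auto
      ultimately have "\<bar>u - x\<bar> < d x" "\<bar>v - x\<bar> < d x" by (auto simp: dist_real_def abs_minus_commute)
      then have 1: "norm (f u - f x) \<le> e * \<bar>u - x\<bar>" "norm (f v - f x) \<le> e * \<bar>v - x\<bar>"
        using d(2)[OF xab, of u] d(2)[OF xab, of v] uv t by auto
      have "norm (f v - f u) \<le> norm (f v - f x) + norm (f u - f x)"
        using norm_triangle_ineq4[of "f v - f x" "f u - f x"] by simp
      also have "\<dots> \<le> e * (v - x) + e * (x - u)" using 1 uv by (simp add: abs_if split: if_splits)
      finally show "\<phi> K \<le> e * measure lborel K" using uv by (simp add: \<phi>_def algebra_simps)
    qed
    also have "\<dots> \<le> (\<Sum>(x, K)\<in>p. e * measure lborel K)"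
      using e finp by (intro sum_mono2) auto
    also have "\<dots> = e * (\<Sum>(x, K)\<in>p. measure lborel K)" by (simp add: sum_distrib_left case_prod_unfold)
    also have "\<dots> = e * (t - a)"
      using additive_content_tagged_division[of p a t] p(1) t by simp
    finally have good: "(\<Sum>(x, K)\<in>p - p1. \<phi> K) \<le> e * (t - a)" .
    have "f t - f a = (\<Sum>(x, K)\<in>p. f (Sup K) - f (Inf K))"
      using additive_tagged_division_1[OF _ p(1), of f] t by simp
    also have "norm \<dots> \<le> (\<Sum>(x, K)\<in>p. norm (f (Sup K) - f (Inf K)))"
      unfolding case_prod_unfold by (rule norm_sum)
    also have "\<dots> = (\<Sum>(x, K)\<in>p. \<phi> K)"
      using tagged_division_ofD(2)[OF p(1)] by (intro sum.cong) (force simp: \<phi>_def)+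
    also have "\<dots> = (\<Sum>(x, K)\<in>p - p1. \<phi> K) + (\<Sum>(x, K)\<in>p1. \<phi> K)"
      by (rule sum.subset_diff[OF p1 finp])
    also have "\<dots> \<le> e * (t - a) + e" using good bad by simp
    finally show ?thesis by (simp add: algebra_simps)
  qed
  note bound = this
  have "norm (f t - f a) \<le> 0 + e" if "0 < e" for e
  proof -
    have pos: "0 < 1 + (t - a)" using t by simp
    then show ?thesis using bound[of "e / (1 + (t - a))"] that by simp
  qed
  then have "norm (f t - f a) \<le> 0" by (rule field_le_epsilon)
  then show ?thesis by simp
qed

lemma bounded_almost_continuous_integrable:
  fixes g :: "real \<Rightarrow> 'a::euclidean_space"
  assumes F: "finite F" and cont: "\<And>s. s \<in> {a..b} - F \<Longrightarrow> continuous (at s within {a..b}) g"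
    and B: "\<And>s. s \<in> {a..b} \<Longrightarrow> norm (g s) \<le> B"
  shows "g integrable_on {a..b}"
proof -
  have "continuous_on ({a..b} - F) g"
    unfolding continuous_on_eq_continuous_within
    by (blast intro: continuous_within_subset[OF cont])
  moreover have S: "{a..b} - F \<in> sets lebesgue"
    using F by (intro sets.Diff) (auto simp: negligible_imp_sets negligible_finite)
  ultimately have "g \<in> borel_measurable (lebesgue_on ({a..b} - F))"
    by (rule continuous_imp_measurable_on_sets_lebesgue)
  moreover have "(\<lambda>_. B) integrable_on ({a..b} - F)"
    by (rule integrable_spike_set[where S = "{a..b}"])
       (auto intro: negligible_subset[OF negligible_finite[OF F]])
  ultimately have "g integrable_on ({a..b} - F)"
    by (rule measurable_bounded_by_integrable_imp_integrable) (use B S in auto)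
  then show ?thesis
    by (rule integrable_spike_set) (auto intro: negligible_subset[OF negligible_finite[OF F]])
qed

section \<open>Horizontal curves\<close>

text \<open>The controls \<open>u\<close>, \<open>v\<close> include the size factor, so that reparametrisations and changes of
  size are both plain changes of the controls.\<close>

definition horizontal ::
    "(complex \<Rightarrow> real) \<Rightarrow> (real \<Rightarrow> real) \<Rightarrow> (real \<Rightarrow> real) \<Rightarrow> (real \<Rightarrow> complex \<times> real) \<Rightarrow> bool" where
  "horizontal P u v \<gamma> \<longleftrightarrow> continuous_on {0..1} \<gamma> \<and>
     (\<exists>F. finite F \<and> (\<forall>s\<in>{0<..<1} - F.
        (\<gamma> has_vector_derivative u s *\<^sub>R field_X P (\<gamma> s) + v s *\<^sub>R field_Y P (\<gamma> s)) (at s)))"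

text \<open>The controls of \<open>X_star\<close> without the closing condition.\<close>

definition unit_controls :: "((real \<Rightarrow> real) \<times> (real \<Rightarrow> real)) set" where
  "unit_controls = {(\<alpha>, \<beta>). \<alpha> \<in> FPWS \<and> \<beta> \<in> FPWS \<and> (\<forall>s\<in>{0..1}. \<bar>\<alpha> s\<bar>\<^sup>2 + \<bar>\<beta> s\<bar>\<^sup>2 < 1)}"

definition reach :: "(complex \<Rightarrow> real) \<Rightarrow> real \<Rightarrow> complex \<times> real \<Rightarrow> complex \<times> real \<Rightarrow> bool" where
  "reach P \<delta> p q \<longleftrightarrow> (\<exists>(\<alpha>, \<beta>)\<in>unit_controls. \<exists>\<gamma>.
     horizontal P (\<lambda>s. \<alpha> s * \<delta>) (\<lambda>s. \<beta> s * \<delta>) \<gamma> \<and> \<gamma> 0 = p \<and> \<gamma> 1 = q)"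

lemma reachI:
  assumes "(\<alpha>, \<beta>) \<in> unit_controls" "horizontal P (\<lambda>s. \<alpha> s * \<delta>) (\<lambda>s. \<beta> s * \<delta>) \<gamma>"
    "\<gamma> 0 = p" "\<gamma> 1 = q"
  shows "reach P \<delta> p q"
  using assms unfolding reach_def by blast

lemma reachE:
  assumes "reach P \<delta> p q"
  obtains \<alpha> \<beta> \<gamma> where "(\<alpha>, \<beta>) \<in> unit_controls"
    "horizontal P (\<lambda>s. \<alpha> s * \<delta>) (\<lambda>s. \<beta> s * \<delta>) \<gamma>" "\<gamma> 0 = p" "\<gamma> 1 = q"
  using assms unfolding reach_def by blast

lemma unit_controls_bound:
  assumes "(\<alpha>, \<beta>) \<in> unit_controls" "s \<in> {0..1}"
  shows "\<bar>\<alpha> s\<bar> \<le> 1" "\<bar>\<beta> s\<bar> \<le> 1"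
proof -
  have "\<bar>\<alpha> s\<bar>\<^sup>2 + \<bar>\<beta> s\<bar>\<^sup>2 < 1" using assms by (auto simp: unit_controls_def)
  then have "(\<alpha> s)\<^sup>2 \<le> 1" "(\<beta> s)\<^sup>2 \<le> 1"
    using zero_le_power2[of "\<alpha> s"] zero_le_power2[of "\<beta> s"] unfolding power2_abs by linarith+
  then show "\<bar>\<alpha> s\<bar> \<le> 1" "\<bar>\<beta> s\<bar> \<le> 1" by (simp_all add: abs_square_le_1)
qed

lemma horizontal_velocity:
  "u *\<^sub>R field_X P p + v *\<^sub>R field_Y P p =
     (Complex (u / 2) (- v / 2), (u * partial_y P (fst p) + v * partial_x P (fst p)) / 2)"
  by (cases p) (simp add: field_X_def field_Y_def complex_eq_iff add_divide_distrib)

text \<open>The second part is the formula $dt = P_y\,dx - P_x\,dy$ behind the whole proof: the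
  vertical displacement depends on the projected curve only.\<close>

lemma horizontal_displacement:
  assumes h: "horizontal P u v \<gamma>" and ab: "0 \<le> a" "a \<le> b" "b \<le> 1"
  shows "((\<lambda>s. Complex (u s / 2) (- v s / 2)) has_integral fst (\<gamma> b) - fst (\<gamma> a)) {a..b}"
    and "((\<lambda>s. (u s * partial_y P (fst (\<gamma> s)) + v s * partial_x P (fst (\<gamma> s))) / 2)
            has_integral snd (\<gamma> b) - snd (\<gamma> a)) {a..b}"
proof -
  obtain F where F: "finite F"
    and der: "\<And>s. s \<in> {0<..<1} - F \<Longrightarrow>
      (\<gamma> has_vector_derivative u s *\<^sub>R field_X P (\<gamma> s) + v s *\<^sub>R field_Y P (\<gamma> s)) (at s)"
    using h by (auto simp: horizontal_def)
  have "continuous_on {a..b} \<gamma>"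
    using h ab by (auto simp: horizontal_def intro: continuous_on_subset)
  then have I: "((\<lambda>s. u s *\<^sub>R field_X P (\<gamma> s) + v s *\<^sub>R field_Y P (\<gamma> s)) has_integral \<gamma> b - \<gamma> a) {a..b}"
    using ab by (intro fundamental_theorem_of_calculus_interior_strong[OF F] der) auto
  show "((\<lambda>s. Complex (u s / 2) (- v s / 2)) has_integral fst (\<gamma> b) - fst (\<gamma> a)) {a..b}"
    using has_integral_linear[OF I bounded_linear_fst] by (simp add: horizontal_velocity o_def)
  show "((\<lambda>s. (u s * partial_y P (fst (\<gamma> s)) + v s * partial_x P (fst (\<gamma> s))) / 2)
            has_integral snd (\<gamma> b) - snd (\<gamma> a)) {a..b}"
    using has_integral_linear[OF I bounded_linear_snd] by (simp add: horizontal_velocity o_def)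
qed

text \<open>The projection is an integral of the controls, and the projection and the controls
  determine the height.\<close>

lemma horizontal_unique:
  assumes h: "horizontal P u v \<gamma>" "horizontal P u v \<gamma>'" and start: "\<gamma> 0 = \<gamma>' 0" and s: "s \<in> {0..1}"
  shows "\<gamma> s = \<gamma>' s"
proof -
  have z: "fst (\<gamma> r) = fst (\<gamma>' r)" if "r \<in> {0..1}" for r
    using has_integral_unique[OF horizontal_displacement(1)[OF h(1), of 0 r]
        horizontal_displacement(1)[OF h(2), of 0 r]] that start by auto
  have "((\<lambda>r. (u r * partial_y P (fst (\<gamma> r)) + v r * partial_x P (fst (\<gamma> r))) / 2)
            has_integral snd (\<gamma>' s) - snd (\<gamma>' 0)) {0..s}"
    by (rule has_integral_eq[OF _ horizontal_displacement(2)[OF h(2)]]) (use s z in auto)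
  from has_integral_unique[OF horizontal_displacement(2)[OF h(1), of 0 s] this]
  have "snd (\<gamma> s) = snd (\<gamma>' s)" using s start by auto
  with z[OF s] show ?thesis by (simp add: prod_eq_iff)
qed

lemma horizontal_translate:
  assumes "horizontal P u v \<gamma>"
  shows "horizontal P u v (\<lambda>s. \<gamma> s + (0, h))"
proof -
  have field: "field_X P (p + (0, h)) = field_X P p" "field_Y P (p + (0, h)) = field_Y P p" for p
    by (cases p; simp add: field_X_def field_Y_def)+
  have der: "((\<lambda>s. \<gamma> s + (0, h)) has_vector_derivative V) (at s)"
    if "(\<gamma> has_vector_derivative V) (at s)" for V s
    using has_vector_derivative_add[OF that has_vector_derivative_const] by simp
  obtain F where "finite F" "\<forall>s\<in>{0<..<1} - F.
      (\<gamma> has_vector_derivative u s *\<^sub>R field_X P (\<gamma> s) + v s *\<^sub>R field_Y P (\<gamma> s)) (at s)"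
    using assms by (auto simp: horizontal_def)
  moreover have "continuous_on {0..1} (\<lambda>s. \<gamma> s + (0, h))"
    using assms by (intro continuous_on_add continuous_on_const) (auto simp: horizontal_def)
  ultimately show ?thesis
    unfolding horizontal_def field using der by metis
qed

lemma horizontal_reverse:
  assumes "horizontal P u v \<gamma>"
  shows "horizontal P (\<lambda>s. - u (1 - s)) (\<lambda>s. - v (1 - s)) (\<lambda>s. \<gamma> (1 - s))"
proof -
  obtain F where F: "finite F" and cont: "continuous_on {0..1} \<gamma>"
    and der: "\<And>s. s \<in> {0<..<1} - F \<Longrightarrow>
      (\<gamma> has_vector_derivative u s *\<^sub>R field_X P (\<gamma> s) + v s *\<^sub>R field_Y P (\<gamma> s)) (at s)"
    using assms by (auto simp: horizontal_def)
  have "((\<lambda>s. \<gamma> (1 - s)) has_vector_derivative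
      (- u (1 - s)) *\<^sub>R field_X P (\<gamma> (1 - s)) + (- v (1 - s)) *\<^sub>R field_Y P (\<gamma> (1 - s))) (at s)"
    if s: "s \<in> {0<..<1} - (\<lambda>s. 1 - s) ` F" for s
  proof -
    have "1 - s \<notin> F" using s by (auto simp: image_iff)
    then have "1 - s \<in> {0<..<1} - F" using s by auto
    moreover have "((\<lambda>s. 1 - s) has_vector_derivative - 1) (at s)"
      by (auto intro!: derivative_eq_intros)
    ultimately show ?thesis
      using vector_diff_chain_at[OF _ der, of "\<lambda>s. 1 - s" "-1" s] by (simp add: o_def)
  qed
  moreover have "continuous_on {0..1} (\<lambda>s. \<gamma> (1 - s))"
    by (rule continuous_on_compose2[OF cont]) (auto intro!: continuous_intros)
  ultimately show ?thesis unfolding horizontal_def using F by blast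
qed

text \<open>Running a curve in time \<open>m\<close> instead of \<open>1\<close> divides its controls by \<open>m\<close>.\<close>

lemma horizontal_append:
  assumes h1: "horizontal P u1 v1 \<gamma>1" and h2: "horizontal P u2 v2 \<gamma>2"
    and join: "\<gamma>1 1 = \<gamma>2 0" and m: "0 < m" "m < 1"
  shows "horizontal P (\<lambda>s. if s < m then u1 (s / m) / m else u2 ((s - m) / (1 - m)) / (1 - m))
           (\<lambda>s. if s < m then v1 (s / m) / m else v2 ((s - m) / (1 - m)) / (1 - m))
           (\<lambda>s. if s \<le> m then \<gamma>1 (s / m) else \<gamma>2 ((s - m) / (1 - m)))"
    (is "horizontal P ?u ?v ?\<gamma>")
proof -
  obtain F1 where F1: "finite F1" and cont1: "continuous_on {0..1} \<gamma>1"
    and der1: "\<And>s. s \<in> {0<..<1} - F1 \<Longrightarrow>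
      (\<gamma>1 has_vector_derivative u1 s *\<^sub>R field_X P (\<gamma>1 s) + v1 s *\<^sub>R field_Y P (\<gamma>1 s)) (at s)"
    using h1 by (auto simp: horizontal_def)
  obtain F2 where F2: "finite F2" and cont2: "continuous_on {0..1} \<gamma>2"
    and der2: "\<And>s. s \<in> {0<..<1} - F2 \<Longrightarrow>
      (\<gamma>2 has_vector_derivative u2 s *\<^sub>R field_X P (\<gamma>2 s) + v2 s *\<^sub>R field_Y P (\<gamma>2 s)) (at s)"
    using h2 by (auto simp: horizontal_def)
  have "continuous_on {0..1} ?\<gamma>"
  proof (rule continuous_on_cases_le)
    show "continuous_on {t \<in> {0..1}. t \<le> m} (\<lambda>s. \<gamma>1 (s / m))"
      by (rule continuous_on_compose2[OF cont1]) (use m in \<open>auto intro!: continuous_intros\<close>)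
    show "continuous_on {t \<in> {0..1}. m \<le> t} (\<lambda>s. \<gamma>2 ((s - m) / (1 - m)))"
      by (rule continuous_on_compose2[OF cont2]) (use m in \<open>auto intro!: continuous_intros\<close>)
  qed (use m join in \<open>auto intro!: continuous_intros\<close>)
  moreover
  let ?F = "insert m ((\<lambda>s. m * s) ` F1 \<union> (\<lambda>s. m + (1 - m) * s) ` F2)"
  have "(?\<gamma> has_vector_derivative ?u s *\<^sub>R field_X P (?\<gamma> s) + ?v s *\<^sub>R field_Y P (?\<gamma> s)) (at s)"
    if s: "s \<in> {0<..<1} - ?F" for s
  proof (cases "s < m")
    case True
    have "s / m \<notin> F1"
    proof
      assume "s / m \<in> F1"
      then have "m * (s / m) \<in> (\<lambda>s. m * s) ` F1" by (rule imageI)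
      then show False using s m by simp
    qed
    then have "s / m \<in> {0<..<1} - F1" using s True m by auto
    moreover have "((\<lambda>s. s / m) has_vector_derivative 1 / m) (at s)"
      using m by (auto intro!: derivative_eq_intros)
    ultimately have "((\<lambda>s. \<gamma>1 (s / m)) has_vector_derivative
        ?u s *\<^sub>R field_X P (?\<gamma> s) + ?v s *\<^sub>R field_Y P (?\<gamma> s)) (at s)"
      using vector_diff_chain_at[OF _ der1, of "\<lambda>s. s / m" "1 / m" s] True
      by (simp add: o_def scaleR_add_right)
    then show ?thesis
      by (rule has_vector_derivative_transform_within_open[where S = "{..<m}"]) (use True in auto)
  next
    case False
    then have sm: "m < s" using s by auto
    have "(s - m) / (1 - m) \<notin> F2"
    proof
      assume "(s - m) / (1 - m) \<in> F2"
      then have "m + (1 - m) * ((s - m) / (1 - m)) \<in> (\<lambda>s. m + (1 - m) * s) ` F2" by (rule imageI)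
      then show False using s m by simp
    qed
    then have "(s - m) / (1 - m) \<in> {0<..<1} - F2" using s sm m by auto
    moreover have "((\<lambda>s. (s - m) / (1 - m)) has_vector_derivative 1 / (1 - m)) (at s)"
      using m by (auto intro!: derivative_eq_intros)
    ultimately have "((\<lambda>s. \<gamma>2 ((s - m) / (1 - m))) has_vector_derivative
        ?u s *\<^sub>R field_X P (?\<gamma> s) + ?v s *\<^sub>R field_Y P (?\<gamma> s)) (at s)"
      using vector_diff_chain_at[OF _ der2, of "\<lambda>s. (s - m) / (1 - m)" "1 / (1 - m)" s] sm
      by (simp add: o_def scaleR_add_right)
    then show ?thesis
      by (rule has_vector_derivative_transform_within_open[where S = "{m<..}"]) (use sm in auto)
  qed
  moreover have "finite ?F" using F1 F2 by simp
  ultimately show ?thesis unfolding horizontal_def by blast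
qed

lemma reach_trans:
  assumes d: "0 < \<delta>1" "0 < \<delta>2" and r1: "reach P \<delta>1 p q" and r2: "reach P \<delta>2 q r"
  shows "reach P (\<delta>1 + \<delta>2) p r"
proof -
  obtain \<alpha>1 \<beta>1 \<gamma>1 where 1: "(\<alpha>1, \<beta>1) \<in> unit_controls"
    "horizontal P (\<lambda>s. \<alpha>1 s * \<delta>1) (\<lambda>s. \<beta>1 s * \<delta>1) \<gamma>1" "\<gamma>1 0 = p" "\<gamma>1 1 = q"
    using reachE[OF r1] by blast
  obtain \<alpha>2 \<beta>2 \<gamma>2 where 2: "(\<alpha>2, \<beta>2) \<in> unit_controls"
    "horizontal P (\<lambda>s. \<alpha>2 s * \<delta>2) (\<lambda>s. \<beta>2 s * \<delta>2) \<gamma>2" "\<gamma>2 0 = q" "\<gamma>2 1 = r"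
    using reachE[OF r2] by blast
  \<comment> \<open>The speeds \<open>\<delta>1 / m\<close> and \<open>\<delta>2 / (1 - m)\<close> of the two halves both become \<open>\<delta>1 + \<delta>2\<close>.\<close>
  define m where "m = \<delta>1 / (\<delta>1 + \<delta>2)"
  have m: "0 < m" "m < 1" using d by (auto simp: m_def)
  have m1: "1 - m = \<delta>2 / (\<delta>1 + \<delta>2)" using d by (simp add: m_def field_simps)
  have \<delta>: "x * \<delta>1 / m = x * (\<delta>1 + \<delta>2)" "x * \<delta>2 / (1 - m) = x * (\<delta>1 + \<delta>2)" for x
    using d by (simp_all add: m1) (simp add: m_def)
  let ?app = "\<lambda>f g s. if s < m then f (s / m) else g ((s - m) / (1 - m)) :: real"
  have hor: "horizontal P (\<lambda>s. ?app \<alpha>1 \<alpha>2 s * (\<delta>1 + \<delta>2)) (\<lambda>s. ?app \<beta>1 \<beta>2 s * (\<delta>1 + \<delta>2))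
      (\<lambda>s. if s \<le> m then \<gamma>1 (s / m) else \<gamma>2 ((s - m) / (1 - m)))"
    using horizontal_append[OF 1(2) 2(2) _ m] 1(4) 2(3)
    by (simp add: \<delta> if_distrib[of "\<lambda>x. x * (\<delta>1 + \<delta>2)"] cong: if_cong)
  have "(?app \<alpha>1 \<alpha>2, ?app \<beta>1 \<beta>2) \<in> unit_controls"
    using 1(1) 2(1) m by (auto simp: unit_controls_def FPWS_append)
  from reachI[OF this hor] show ?thesis using m 1 2 by auto
qed

lemma reach_reverse:
  assumes "reach P \<delta> p q"
  shows "reach P \<delta> q p"
proof -
  obtain \<alpha> \<beta> \<gamma> where 1: "(\<alpha>, \<beta>) \<in> unit_controls"
    "horizontal P (\<lambda>s. \<alpha> s * \<delta>) (\<lambda>s. \<beta> s * \<delta>) \<gamma>" "\<gamma> 0 = p" "\<gamma> 1 = q"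
    using reachE[OF assms] by blast
  have "((\<lambda>s. - \<alpha> (1 - s)), (\<lambda>s. - \<beta> (1 - s))) \<in> unit_controls"
    using 1(1) by (auto simp: unit_controls_def FPWS_reverse)
  moreover have "horizontal P (\<lambda>s. - \<alpha> (1 - s) * \<delta>) (\<lambda>s. - \<beta> (1 - s) * \<delta>) (\<lambda>s. \<gamma> (1 - s))"
    using horizontal_reverse[OF 1(2)] by simp
  ultimately show ?thesis by (rule reachI) (use 1 in auto)
qed

lemma reach_translate:
  assumes "reach P \<delta> p q"
  shows "reach P \<delta> (p + (0, h)) (q + (0, h))"
proof -
  obtain \<alpha> \<beta> \<gamma> where 1: "(\<alpha>, \<beta>) \<in> unit_controls"
    "horizontal P (\<lambda>s. \<alpha> s * \<delta>) (\<lambda>s. \<beta> s * \<delta>) \<gamma>" "\<gamma> 0 = p" "\<gamma> 1 = q"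
    using reachE[OF assms] by blast
  from reachI[OF 1(1) horizontal_translate[OF 1(2)]] show ?thesis using 1 by simp
qed

lemma reach_refl: "reach P \<delta> p p"
proof (rule reachI)
  show "((\<lambda>_. 0), (\<lambda>_. 0)) \<in> unit_controls" by (simp add: unit_controls_def FPWS_const)
  show "horizontal P (\<lambda>s. 0 * \<delta>) (\<lambda>s. 0 * \<delta>) (\<lambda>_. p)"
    by (auto simp: horizontal_def)
qed auto

text \<open>Heights add as well as sizes: after one vertical displacement the same loop is run again
  from the translated point.\<close>

lemma reach_vertical_iterate:
  assumes "0 < \<delta>" "reach P \<delta> p (p + (0, h))"
  shows "reach P (real (Suc n) * \<delta>) p (p + (0, real (Suc n) * h))"
proof (induction n)
  case 0 show ?case using assms by simp
next
  case (Suc n)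
  have "reach P \<delta> (p + (0, real (Suc n) * h)) (p + (0, real (Suc n) * h) + (0, h))"
    using reach_translate[OF assms(2), of "real (Suc n) * h"] by (simp add: add_ac del: of_nat_Suc)
  moreover have "0 < real (Suc n) * \<delta>" using assms(1) by simp
  ultimately have "reach P (real (Suc n) * \<delta> + \<delta>) p (p + (0, real (Suc n) * h) + (0, h))"
    using reach_trans assms(1) Suc.IH by blast
  then show ?case by (simp add: algebra_simps)
qed

section \<open>Horizontal curves with prescribed controls\<close>

text \<open>The regularity of the potential under which horizontal curves are given by two successive
  integrations.\<close>

locale C1_potential =
  fixes P :: "complex \<Rightarrow> real"
  assumes continuous_partial_x: "continuous_on UNIV (partial_x P)"
    and continuous_partial_y: "continuous_on UNIV (partial_y P)"
begin

lemma partials_bounded_on_compact: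
  assumes "compact K"
  obtains M where "0 \<le> M" "\<And>z. z \<in> K \<Longrightarrow> \<bar>partial_x P z\<bar> \<le> M" "\<And>z. z \<in> K \<Longrightarrow> \<bar>partial_y P z\<bar> \<le> M"
proof -
  have "bounded (partial_x P ` K)" "bounded (partial_y P ` K)"
    using assms continuous_partial_x continuous_partial_y
    by (auto intro!: compact_imp_bounded compact_continuous_image intro: continuous_on_subset)
  then obtain A B where "\<forall>z\<in>K. \<bar>partial_x P z\<bar> \<le> A" "\<forall>z\<in>K. \<bar>partial_y P z\<bar> \<le> B"
    by (auto simp: bounded_iff)
  then show thesis by (intro that[of "max 0 (max A B)"]) (auto simp: le_max_iff_disj)
qed

lemma partials_bounded_on_path:
  assumes "continuous_on {a..b::real} z"
  obtains M where "0 \<le> M" "\<And>s. s \<in> {a..b} \<Longrightarrow> \<bar>partial_x P (z s)\<bar> \<le> M"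
    "\<And>s. s \<in> {a..b} \<Longrightarrow> \<bar>partial_y P (z s)\<bar> \<le> M"
proof -
  have "compact (z ` {a..b})" by (intro compact_continuous_image assms) simp
  then obtain M where M: "0 \<le> M" "\<And>w. w \<in> z ` {a..b} \<Longrightarrow> \<bar>partial_x P w\<bar> \<le> M"
      "\<And>w. w \<in> z ` {a..b} \<Longrightarrow> \<bar>partial_y P w\<bar> \<le> M"
    by (rule partials_bounded_on_compact) blast
  show thesis by (rule that[OF M(1)]) (rule M(2,3), erule imageI)+
qed

text \<open>The system is triangular: integrating the controls gives the projection, and the height is
  the integral of a function of the projection and the controls. Where the
  controls are continuous the derivative exists even at the endpoints, as integral curves require.\<close>

lemma horizontal_exists:
  assumes F: "finite F"
    and cu: "\<And>s. s \<in> {0..1} - F \<Longrightarrow> continuous (at s within {0..1}) u"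
    and cv: "\<And>s. s \<in> {0..1} - F \<Longrightarrow> continuous (at s within {0..1}) v"
    and B: "\<And>s. s \<in> {0..1} \<Longrightarrow> \<bar>u s\<bar> \<le> B" "\<And>s. s \<in> {0..1} \<Longrightarrow> \<bar>v s\<bar> \<le> B"
  shows "\<exists>\<gamma>. \<gamma> 0 = p \<and> continuous_on {0..1} \<gamma> \<and> (\<forall>s\<in>{0..1} - F.
      (\<gamma> has_vector_derivative u s *\<^sub>R field_X P (\<gamma> s) + v s *\<^sub>R field_Y P (\<gamma> s)) (at s within {0..1}))"
proof -
  have B0: "0 \<le> B" using B(1)[of 0] by simp
  define w where "w s = Complex (u s / 2) (- v s / 2)" for s
  have cw: "continuous (at s within {0..1}) w" if "s \<in> {0..1} - F" for s
    unfolding w_def Complex_eq by (intro continuous_intros cu cv that) auto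
  have "norm (w s) \<le> B" if "s \<in> {0..1}" for s
  proof -
    have "norm (w s) \<le> \<bar>u s / 2\<bar> + \<bar>- v s / 2\<bar>"
      using cmod_le[of "w s"] by (simp add: w_def)
    also have "\<dots> \<le> B" using B[OF that] by simp
    finally show ?thesis .
  qed
  from bounded_almost_continuous_integrable[OF F cw this]
  have wI: "w integrable_on {0..1}" .
  define z where "z s = fst p + integral {0..s} w" for s
  have z_cont: "continuous_on {0..1} z"
    unfolding z_def by (intro continuous_intros indefinite_integral_continuous_1 wI)
  have z_der: "(z has_vector_derivative w s) (at s within {0..1})" if s: "s \<in> {0..1} - F" for s
    using integral_has_vector_derivative_continuous_at[OF wI, of s "{}"] cw[OF s] s
    unfolding z_def by (auto intro!: derivative_eq_intros)
  have px: "continuous_on {0..1} (\<lambda>s. partial_x P (z s))" "continuous_on {0..1} (\<lambda>s. partial_y P (z s))"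
    using continuous_on_compose2[OF continuous_partial_x z_cont]
      continuous_on_compose2[OF continuous_partial_y z_cont] by auto
  obtain M where M: "0 \<le> M" "\<And>s. s \<in> {0..1} \<Longrightarrow> \<bar>partial_x P (z s)\<bar> \<le> M"
      "\<And>s. s \<in> {0..1} \<Longrightarrow> \<bar>partial_y P (z s)\<bar> \<le> M"
    by (rule partials_bounded_on_path[OF z_cont]) blast
  define g where "g s = (u s * partial_y P (z s) + v s * partial_x P (z s)) / 2" for s
  have cg: "continuous (at s within {0..1}) g" if "s \<in> {0..1} - F" for s
    unfolding g_def using that px
    by (intro continuous_intros cu cv) (auto simp: continuous_on_eq_continuous_within)
  have "norm (g s) \<le> B * M" if s: "s \<in> {0..1}" for s
  proof -
    have "\<bar>u s * partial_y P (z s)\<bar> \<le> B * M" "\<bar>v s * partial_x P (z s)\<bar> \<le> B * M"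
      unfolding abs_mult using B[OF s] M(2,3)[OF s] B0 M(1) by (auto intro!: mult_mono)
    then show ?thesis unfolding g_def by simp
  qed
  from bounded_almost_continuous_integrable[OF F cg this]
  have gI: "g integrable_on {0..1}" .
  define t where "t s = snd p + integral {0..s} g" for s
  have t_cont: "continuous_on {0..1} t"
    unfolding t_def by (intro continuous_intros indefinite_integral_continuous_1 gI)
  have t_der: "(t has_vector_derivative g s) (at s within {0..1})" if s: "s \<in> {0..1} - F" for s
    using integral_has_vector_derivative_continuous_at[OF gI, of s "{}"] cg[OF s] s
    unfolding t_def by (auto intro!: derivative_eq_intros)
  show ?thesis
  proof (intro exI[of _ "\<lambda>s. (z s, t s)"] conjI ballI)
    show "(z 0, t 0) = p" by (simp add: z_def t_def)
    show "continuous_on {0..1} (\<lambda>s. (z s, t s))" by (intro continuous_intros z_cont t_cont)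
    fix s assume s: "s \<in> {0..1} - F"
    show "((\<lambda>s. (z s, t s)) has_vector_derivative
        u s *\<^sub>R field_X P (z s, t s) + v s *\<^sub>R field_Y P (z s, t s)) (at s within {0..1})"
      using has_vector_derivative_Pair[OF z_der[OF s] t_der[OF s]]
      by (simp add: horizontal_velocity w_def g_def)
  qed
qed

lemma unit_controls_horizontal_exists:
  assumes "(\<alpha>, \<beta>) \<in> unit_controls"
  obtains \<gamma> where "\<gamma> 0 = p" "horizontal P (\<lambda>s. \<alpha> s * \<delta>) (\<lambda>s. \<beta> s * \<delta>) \<gamma>"
proof -
  have ab: "\<alpha> \<in> FPWS" "\<beta> \<in> FPWS" using assms by (auto simp: unit_controls_def)
  obtain F where F: "finite F" "0 \<in> F" "1 \<in> F" "\<And>s. s \<in> {0..1} - F \<Longrightarrow> isCont \<alpha> s"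
    by (rule FPWS_isCont[OF ab(1)]) blast
  obtain G where G: "finite G" "0 \<in> G" "1 \<in> G" "\<And>s. s \<in> {0..1} - G \<Longrightarrow> isCont \<beta> s"
    by (rule FPWS_isCont[OF ab(2)]) blast
  have fin: "finite (F \<union> G)" using F G by simp
  have "continuous (at s within {0..1}) \<alpha>" "continuous (at s within {0..1}) \<beta>"
    if "s \<in> {0..1} - (F \<union> G)" for s
    using F(4)[of s] G(4)[of s] that by (simp_all add: continuous_at_imp_continuous_at_within)
  then have cont: "continuous (at s within {0..1}) (\<lambda>s. \<alpha> s * \<delta>)"
      "continuous (at s within {0..1}) (\<lambda>s. \<beta> s * \<delta>)" if "s \<in> {0..1} - (F \<union> G)" for s
    using that by (simp_all add: continuous_mult_right)
  have bound: "\<bar>\<alpha> s * \<delta>\<bar> \<le> \<bar>\<delta>\<bar>" "\<bar>\<beta> s * \<delta>\<bar> \<le> \<bar>\<delta>\<bar>" if "s \<in> {0..1}" for s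
    using unit_controls_bound[OF assms that] by (simp_all add: abs_mult mult_left_le_one_le)
  obtain \<gamma> where "\<gamma> 0 = p" "continuous_on {0..1} \<gamma>"
    and der: "\<And>s. s \<in> {0..1} - (F \<union> G) \<Longrightarrow> (\<gamma> has_vector_derivative
        (\<alpha> s * \<delta>) *\<^sub>R field_X P (\<gamma> s) + (\<beta> s * \<delta>) *\<^sub>R field_Y P (\<gamma> s)) (at s within {0..1})"
    using horizontal_exists[OF fin cont bound, of p] by blast
  moreover have "\<forall>s\<in>{0<..<1} - (F \<union> G). (\<gamma> has_vector_derivative
        (\<alpha> s * \<delta>) *\<^sub>R field_X P (\<gamma> s) + (\<beta> s * \<delta>) *\<^sub>R field_Y P (\<gamma> s)) (at s)"
  proof
    fix s assume s: "s \<in> {0<..<1} - (F \<union> G)"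
    then have "at s within {0..1} = at s" by (intro at_within_Icc_at) auto
    then show "(\<gamma> has_vector_derivative
        (\<alpha> s * \<delta>) *\<^sub>R field_X P (\<gamma> s) + (\<beta> s * \<delta>) *\<^sub>R field_Y P (\<gamma> s)) (at s)"
      using der[of s] s by simp
  qed
  ultimately have "horizontal P (\<lambda>s. \<alpha> s * \<delta>) (\<lambda>s. \<beta> s * \<delta>) \<gamma>"
    unfolding horizontal_def using fin by blast
  with \<open>\<gamma> 0 = p\<close> show thesis by (rule that)
qed

text \<open>The velocity is bounded, because the projected curve stays in a compact set; hence the
  curve is Lipschitz.\<close>

lemma unit_controls_horizontal_abs_continuous:
  assumes ctrl: "(\<alpha>, \<beta>) \<in> unit_controls"
    and h: "horizontal P (\<lambda>s. \<alpha> s * \<delta>) (\<lambda>s. \<beta> s * \<delta>) \<gamma>"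
  shows "abs_continuous_on 0 1 \<gamma>"
proof -
  obtain F where F: "finite F" and cont: "continuous_on {0..1} \<gamma>"
    and der: "\<And>s. s \<in> {0<..<1} - F \<Longrightarrow> (\<gamma> has_vector_derivative
      (\<alpha> s * \<delta>) *\<^sub>R field_X P (\<gamma> s) + (\<beta> s * \<delta>) *\<^sub>R field_Y P (\<gamma> s)) (at s)"
    using h by (auto simp: horizontal_def)
  obtain M where M: "0 \<le> M" "\<And>s. s \<in> {0..1} \<Longrightarrow> \<bar>partial_x P (fst (\<gamma> s))\<bar> \<le> M"
      "\<And>s. s \<in> {0..1} \<Longrightarrow> \<bar>partial_y P (fst (\<gamma> s))\<bar> \<le> M"
    by (rule partials_bounded_on_path[OF continuous_on_fst[OF cont]]) blast
  let ?V = "\<lambda>s. (\<alpha> s * \<delta>) *\<^sub>R field_X P (\<gamma> s) + (\<beta> s * \<delta>) *\<^sub>R field_Y P (\<gamma> s)"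
  let ?L = "\<bar>\<delta>\<bar> + \<bar>\<delta>\<bar> * M"
  have V: "norm (?V s) \<le> ?L" if s: "s \<in> {0..1}" for s
  proof -
    have ab: "\<bar>\<alpha> s * \<delta>\<bar> \<le> \<bar>\<delta>\<bar>" "\<bar>\<beta> s * \<delta>\<bar> \<le> \<bar>\<delta>\<bar>"
      using unit_controls_bound[OF ctrl s] by (simp_all add: abs_mult mult_left_le_one_le)
    have "\<bar>(\<alpha> s * \<delta>) * partial_y P (fst (\<gamma> s))\<bar> \<le> \<bar>\<delta>\<bar> * M"
      "\<bar>(\<beta> s * \<delta>) * partial_x P (fst (\<gamma> s))\<bar> \<le> \<bar>\<delta>\<bar> * M"
      unfolding abs_mult[of _ "partial_y P _"] abs_mult[of _ "partial_x P _"]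
      using ab M(2,3)[OF s] M(1) by (auto intro!: mult_mono)
    then have "\<bar>snd (?V s)\<bar> \<le> \<bar>\<delta>\<bar> * M" unfolding horizontal_velocity by simp
    moreover have "norm (fst (?V s)) \<le> \<bar>\<delta>\<bar>"
      using cmod_le[of "fst (?V s)"] ab unfolding horizontal_velocity by simp
    moreover have "norm (?V s) \<le> norm (fst (?V s)) + \<bar>snd (?V s)\<bar>"
      using norm_Pair_le[of "fst (?V s)" "snd (?V s)"] unfolding prod.collapse real_norm_def .
    ultimately show ?thesis by linarith
  qed
  show ?thesis
  proof (rule Lipschitz_imp_abs_continuous_on)
    fix a b :: real assume ab: "0 \<le> a" "a \<le> b" "b \<le> 1"
    have "continuous_on {a..b} \<gamma>" using cont ab by (auto intro: continuous_on_subset)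
    then have I: "(?V has_integral \<gamma> b - \<gamma> a) (cbox a b)"
      unfolding cbox_interval using ab
      by (intro fundamental_theorem_of_calculus_interior_strong[OF F] der) auto
    show "norm (\<gamma> b - \<gamma> a) \<le> ?L * (b - a)"
      using has_integral_bound[OF _ I, of ?L] V ab M(1) by auto
  qed
qed

lemma reach_imp_cc_admissible:
  assumes "reach P \<delta> p q"
  shows "cc_admissible P p q \<delta>"
proof -
  obtain \<alpha> \<beta> \<gamma> where ctrl: "(\<alpha>, \<beta>) \<in> unit_controls"
    and h: "horizontal P (\<lambda>s. \<alpha> s * \<delta>) (\<lambda>s. \<beta> s * \<delta>) \<gamma>" and ends: "\<gamma> 0 = p" "\<gamma> 1 = q"
    using reachE[OF assms] by blast
  obtain F where F: "finite F"
    and der: "\<And>s. s \<in> {0<..<1} - F \<Longrightarrow> (\<gamma> has_vector_derivative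
      (\<alpha> s * \<delta>) *\<^sub>R field_X P (\<gamma> s) + (\<beta> s * \<delta>) *\<^sub>R field_Y P (\<gamma> s)) (at s)"
    using h by (auto simp: horizontal_def)
  have "negligible (insert 0 (insert 1 F))" using F by (intro negligible_finite) simp
  then have null: "insert 0 (insert 1 F) \<in> null_sets lebesgue" by (simp add: negligible_iff_null_sets)
  have "AE s in lebesgue_on {0..1}. (\<gamma> has_vector_derivative
      (\<alpha> s * \<delta>) *\<^sub>R field_X P (\<gamma> s) + (\<beta> s * \<delta>) *\<^sub>R field_Y P (\<gamma> s)) (at s within {0..1})"
  proof (subst AE_restrict_space_iff)
    show "AE s in lebesgue. s \<in> {0..1} \<longrightarrow> (\<gamma> has_vector_derivative
      (\<alpha> s * \<delta>) *\<^sub>R field_X P (\<gamma> s) + (\<beta> s * \<delta>) *\<^sub>R field_Y P (\<gamma> s)) (at s within {0..1})"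
    proof (rule AE_I'[OF null], rule subsetI, rule ccontr)
      fix s assume s: "s \<in> {s \<in> space lebesgue. \<not> (s \<in> {0..1} \<longrightarrow> (\<gamma> has_vector_derivative
          (\<alpha> s * \<delta>) *\<^sub>R field_X P (\<gamma> s) + (\<beta> s * \<delta>) *\<^sub>R field_Y P (\<gamma> s)) (at s within {0..1}))}"
        and "s \<notin> insert 0 (insert 1 F)"
      then have "s \<in> {0<..<1} - F" by auto
      from has_vector_derivative_at_within[OF der[OF this]] s show False by blast
    qed
  qed simp
  moreover have "AE s in lebesgue_on {0..1}. \<bar>\<alpha> s\<bar>\<^sup>2 + \<bar>\<beta> s\<bar>\<^sup>2 < 1"
    using ctrl by (intro AE_I2) (auto simp: unit_controls_def)
  ultimately show ?thesis
    using ends unit_controls_horizontal_abs_continuous[OF ctrl h] ctrl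
    unfolding cc_admissible_def unit_controls_def by blast
qed

section \<open>Admissible paths as horizontal curves\<close>

text \<open>Almost everywhere \<open>\<alpha>\<^sup>2 + \<beta>\<^sup>2 < 1\<close> gives only \<open>\<alpha>\<^sup>2 + \<beta>\<^sup>2 \<le> 1\<close> at the points of continuity
  (equality may occur on a null set) and nothing at the breakpoints. A factor \<open>c < 1\<close> restores the
  strict inequality, and the values at the breakpoints are replaced by zero.\<close>

lemma AE_bound_unit_controls:
  assumes ab: "\<alpha> \<in> FPWS" "\<beta> \<in> FPWS"
    and ae: "AE s in lebesgue_on {0..1}. \<bar>\<alpha> s\<bar>\<^sup>2 + \<bar>\<beta> s\<bar>\<^sup>2 < 1"
    and c: "0 \<le> c" "c < 1"
  obtains F \<alpha>' \<beta>' where "finite F" "(\<alpha>', \<beta>') \<in> unit_controls"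
    "\<And>s. s \<notin> F \<Longrightarrow> \<alpha>' s = c * \<alpha> s" "\<And>s. s \<notin> F \<Longrightarrow> \<beta>' s = c * \<beta> s"
proof -
  obtain F1 where F1: "finite F1" "0 \<in> F1" "1 \<in> F1" "\<And>s. s \<in> {0..1} - F1 \<Longrightarrow> isCont \<alpha> s"
    by (rule FPWS_isCont[OF ab(1)]) blast
  obtain F2 where F2: "finite F2" "0 \<in> F2" "1 \<in> F2" "\<And>s. s \<in> {0..1} - F2 \<Longrightarrow> isCont \<beta> s"
    by (rule FPWS_isCont[OF ab(2)]) blast
  define F where "F = F1 \<union> F2"
  have F: "finite F" "0 \<in> F" "1 \<in> F" using F1 F2 by (auto simp: F_def)
  define S where "S = {0<..<1} - F"
  have opS: "open S" unfolding S_def using F by (simp add: finite_imp_closed open_Diff)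
  have contS: "continuous_on S (\<lambda>s. (\<alpha> s)\<^sup>2 + (\<beta> s)\<^sup>2)"
    by (intro continuous_intros continuous_at_imp_continuous_on ballI F1(4) F2(4))
       (auto simp: S_def F_def)
  have le1: "(\<alpha> s)\<^sup>2 + (\<beta> s)\<^sup>2 \<le> 1" if s: "s \<in> S" for s
  proof (rule ccontr)
    assume gt: "\<not> (\<alpha> s)\<^sup>2 + (\<beta> s)\<^sup>2 \<le> 1"
    \<comment> \<open>By continuity the violation would persist on an open set, which is not negligible.\<close>
    define U where "U = S \<inter> (\<lambda>s. (\<alpha> s)\<^sup>2 + (\<beta> s)\<^sup>2) -` {1<..}"
    have "open U" unfolding U_def by (rule continuous_open_preimage[OF contS opS]) simp
    moreover have "s \<in> U" using s gt by (simp add: U_def)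
    ultimately have "\<not> negligible U" using open_not_negligible by blast
    have "AE s in lebesgue. s \<in> {0..1} \<longrightarrow> \<bar>\<alpha> s\<bar>\<^sup>2 + \<bar>\<beta> s\<bar>\<^sup>2 < 1"
      using ae by (subst (asm) AE_restrict_space_iff) auto
    then obtain N where N: "N \<in> null_sets lebesgue"
      "{s \<in> space lebesgue. \<not> (s \<in> {0..1} \<longrightarrow> \<bar>\<alpha> s\<bar>\<^sup>2 + \<bar>\<beta> s\<bar>\<^sup>2 < 1)} \<subseteq> N"
      by (auto simp: eventually_ae_filter)
    have "U \<subseteq> N" using N(2) by (fastforce simp: U_def S_def)
    then have "negligible U" using N(1) by (meson negligible_iff_null_sets negligible_subset)
    with \<open>\<not> negligible U\<close> show False ..
  qed
  define \<alpha>' where "\<alpha>' s = (if s \<in> F then 0 else c * \<alpha> s)" for s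
  define \<beta>' where "\<beta>' s = (if s \<in> F then 0 else c * \<beta> s)" for s
  have "\<alpha>' \<in> FPWS" by (rule FPWS_scale_change_finite[OF ab(1) F(1), of _ c]) (simp add: \<alpha>'_def)
  moreover have "\<beta>' \<in> FPWS" by (rule FPWS_scale_change_finite[OF ab(2) F(1), of _ c]) (simp add: \<beta>'_def)
  moreover have "\<bar>\<alpha>' s\<bar>\<^sup>2 + \<bar>\<beta>' s\<bar>\<^sup>2 < 1" if s: "s \<in> {0..1}" for s
  proof (cases "s \<in> F")
    case True then show ?thesis by (simp add: \<alpha>'_def \<beta>'_def)
  next
    case False
    then have "s \<noteq> 0" "s \<noteq> 1" using F by auto
    then have "s \<in> S" using False s by (simp add: S_def)
    have "\<bar>\<alpha>' s\<bar>\<^sup>2 + \<bar>\<beta>' s\<bar>\<^sup>2 = c\<^sup>2 * ((\<alpha> s)\<^sup>2 + (\<beta> s)\<^sup>2)"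
      using False by (simp add: \<alpha>'_def \<beta>'_def power_mult_distrib algebra_simps)
    also have "\<dots> \<le> c\<^sup>2 * 1" using le1[OF \<open>s \<in> S\<close>] by (intro mult_left_mono) auto
    also have "\<dots> < 1" using c by (simp add: abs_square_less_1)
    finally show ?thesis .
  qed
  ultimately have "(\<alpha>', \<beta>') \<in> unit_controls" by (simp add: unit_controls_def)
  then show thesis
    by (rule that[OF F(1)]) (simp_all add: \<alpha>'_def \<beta>'_def)
qed

text \<open>The room between \<open>\<delta>'\<close> and \<open>\<delta>\<close> pays for making the bound on the controls strict everywhere.
  The horizontal curve with these controls is compared with the given path: the difference is
  absolutely continuous with derivative zero almost everywhere, first in the projection, and then,
  once the projections are known to agree, in the height.\<close>

lemma cc_admissible_imp_reach:
  assumes adm: "cc_admissible P p q \<delta>'" and d: "0 < \<delta>'" "\<delta>' < \<delta>"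
  shows "reach P \<delta> p q"
proof -
  obtain \<gamma> \<alpha> \<beta> where ab: "\<alpha> \<in> FPWS" "\<beta> \<in> FPWS"
    and ac: "abs_continuous_on 0 1 \<gamma>" and ends: "\<gamma> 0 = p" "\<gamma> 1 = q"
    and bd: "AE s in lebesgue_on {0..1}. \<bar>\<alpha> s\<bar>\<^sup>2 + \<bar>\<beta> s\<bar>\<^sup>2 < 1"
    and ode: "AE s in lebesgue_on {0..1}. (\<gamma> has_vector_derivative
              (\<alpha> s * \<delta>') *\<^sub>R field_X P (\<gamma> s) + (\<beta> s * \<delta>') *\<^sub>R field_Y P (\<gamma> s)) (at s within {0..1})"
    using adm unfolding cc_admissible_def by blast
  define c where "c = \<delta>' / \<delta>"
  have c: "0 \<le> c" "c < 1" "c * \<delta> = \<delta>'" using d by (auto simp: c_def)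
  obtain F \<alpha>' \<beta>' where F: "finite F" and ctrl: "(\<alpha>', \<beta>') \<in> unit_controls"
    and \<alpha>': "\<And>s. s \<notin> F \<Longrightarrow> \<alpha>' s = c * \<alpha> s" and \<beta>': "\<And>s. s \<notin> F \<Longrightarrow> \<beta>' s = c * \<beta> s"
    by (rule AE_bound_unit_controls[OF ab bd c(1,2)]) blast
  obtain \<gamma>' where start: "\<gamma>' 0 = p"
    and hor: "horizontal P (\<lambda>s. \<alpha>' s * \<delta>) (\<lambda>s. \<beta>' s * \<delta>) \<gamma>'"
    using unit_controls_horizontal_exists[OF ctrl, of p \<delta>] by blast
  obtain G where G: "finite G"
    and der': "\<And>s. s \<in> {0<..<1} - G \<Longrightarrow> (\<gamma>' has_vector_derivative
      (\<alpha>' s * \<delta>) *\<^sub>R field_X P (\<gamma>' s) + (\<beta>' s * \<delta>) *\<^sub>R field_Y P (\<gamma>' s)) (at s)"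
    using hor by (auto simp: horizontal_def)
  have "AE s in lebesgue. s \<in> {0..1} \<longrightarrow> (\<gamma> has_vector_derivative
      (\<alpha> s * \<delta>') *\<^sub>R field_X P (\<gamma> s) + (\<beta> s * \<delta>') *\<^sub>R field_Y P (\<gamma> s)) (at s within {0..1})"
    using ode by (subst (asm) AE_restrict_space_iff) auto
  then obtain N0 where N0: "N0 \<in> null_sets lebesgue"
    "{s \<in> space lebesgue. \<not> (s \<in> {0..1} \<longrightarrow> (\<gamma> has_vector_derivative
      (\<alpha> s * \<delta>') *\<^sub>R field_X P (\<gamma> s) + (\<beta> s * \<delta>') *\<^sub>R field_Y P (\<gamma> s)) (at s within {0..1}))} \<subseteq> N0"
    by (auto simp: eventually_ae_filter)
  define N where "N = N0 \<union> insert 0 (insert 1 (F \<union> G))"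
  have "negligible N0" using N0(1) by (simp add: negligible_iff_null_sets)
  moreover have "negligible (insert 0 (insert 1 (F \<union> G)))" using F G by (intro negligible_finite) simp
  ultimately have N: "negligible N" unfolding N_def by (rule negligible_Un)
  let ?u = "\<lambda>s. \<alpha> s * \<delta>'" and ?v = "\<lambda>s. \<beta> s * \<delta>'"
  define D where "D s = \<gamma> s - \<gamma>' s" for s
  have D_der: "(D has_vector_derivative
      (?u s *\<^sub>R field_X P (\<gamma> s) + ?v s *\<^sub>R field_Y P (\<gamma> s))
      - (?u s *\<^sub>R field_X P (\<gamma>' s) + ?v s *\<^sub>R field_Y P (\<gamma>' s))) (at s within {0..1})"
    if s: "s \<in> {0..1} - N" for s
  proof -
    have "s \<notin> N0" using s by (simp add: N_def)
    then have "(\<gamma> has_vector_derivative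
      ?u s *\<^sub>R field_X P (\<gamma> s) + ?v s *\<^sub>R field_Y P (\<gamma> s)) (at s within {0..1})"
      using subsetD[OF N0(2), of s] s by force
    moreover have "s \<noteq> 0" "s \<noteq> 1" "s \<notin> F" "s \<notin> G" using s by (auto simp: N_def)
    then have "s \<in> {0<..<1} - G" using s by auto
    from has_vector_derivative_at_within[OF der'[OF this]]
    have "(\<gamma>' has_vector_derivative
      ?u s *\<^sub>R field_X P (\<gamma>' s) + ?v s *\<^sub>R field_Y P (\<gamma>' s)) (at s within {0..1})"
      unfolding \<alpha>'[OF \<open>s \<notin> F\<close>] \<beta>'[OF \<open>s \<notin> F\<close>] c(3)[symmetric] by (simp add: mult_ac)
    ultimately show ?thesis unfolding D_def by (rule has_vector_derivative_diff)
  qed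
  have D_ac: "abs_continuous_on 0 1 D" unfolding D_def
    by (intro abs_continuous_on_diff ac unit_controls_horizontal_abs_continuous[OF ctrl hor])
  have D0: "D 0 = 0" using ends start by (simp add: D_def)
  have fst_eq: "fst (D s) = 0" if s: "s \<in> {0..1}" for s
  proof -
    have "abs_continuous_on 0 1 (\<lambda>s. fst (D s))"
    proof (rule abs_continuous_on_dominated[OF D_ac])
      fix a b
      have "norm (fst (D b - D a)) \<le> norm (D b - D a)"
        using norm_fst_le[of "fst (D b - D a)" "snd (D b - D a)"] unfolding prod.collapse .
      then show "norm (fst (D b) - fst (D a)) \<le> norm (D b - D a)" by simp
    qed
    moreover have "((\<lambda>s. fst (D s)) has_vector_derivative 0) (at s within {0..1})"
      if s: "s \<in> {0..1} - N" for s
      using bounded_linear.has_vector_derivative[OF bounded_linear_fst D_der[OF s]]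
      unfolding horizontal_velocity by simp
    ultimately have "fst (D s) = fst (D 0)"
      using abs_continuous_zero_derivative_imp_eq[OF _ N] s by blast
    then show ?thesis by (simp add: D0)
  qed
  have snd_eq: "snd (D s) = 0" if s: "s \<in> {0..1}" for s
  proof -
    have "abs_continuous_on 0 1 (\<lambda>s. snd (D s))"
    proof (rule abs_continuous_on_dominated[OF D_ac])
      fix a b
      have "norm (snd (D b - D a)) \<le> norm (D b - D a)"
        using norm_snd_le[of "snd (D b - D a)" "fst (D b - D a)"] unfolding prod.collapse .
      then show "norm (snd (D b) - snd (D a)) \<le> norm (D b - D a)" by simp
    qed
    moreover have "((\<lambda>s. snd (D s)) has_vector_derivative 0) (at s within {0..1})"
      if s: "s \<in> {0..1} - N" for s
    proof -
      have "fst (\<gamma> s) = fst (\<gamma>' s)" using fst_eq[of s] s by (simp add: D_def)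
      then show ?thesis
        using bounded_linear.has_vector_derivative[OF bounded_linear_snd D_der[OF s]]
        unfolding horizontal_velocity by simp
    qed
    ultimately have "snd (D s) = snd (D 0)"
      using abs_continuous_zero_derivative_imp_eq[OF _ N] s by blast
    then show ?thesis by (simp add: D0)
  qed
  have "D 1 = 0" using fst_eq[of 1] snd_eq[of 1] by (simp add: prod_eq_iff)
  then have "\<gamma>' 1 = q" using ends by (simp add: D_def)
  from reachI[OF ctrl hor start this] show ?thesis .
qed

section \<open>Vertical displacement along loops\<close>

lemma X_star_unit_controls: "(\<alpha>, \<beta>) \<in> X_star \<Longrightarrow> (\<alpha>, \<beta>) \<in> unit_controls"
  by (auto simp: X_star_def unit_controls_def)

text \<open>The coordinates of the projection are the functions from the definition of \<open>Lambda_path\<close>.\<close>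

lemma horizontal_fst_loop:
  assumes hor: "horizontal P (\<lambda>s. \<alpha> s * \<delta>) (\<lambda>s. \<beta> s * \<delta>) \<gamma>" and r: "r \<in> {0..1}" and \<delta>: "\<delta> \<noteq> 0"
  shows "\<alpha> integrable_on {0..r}" "\<beta> integrable_on {0..r}"
    and "fst (\<gamma> r) = Complex (loop_x (fst (\<gamma> 0)) \<delta> \<alpha> r) (loop_y (fst (\<gamma> 0)) \<delta> \<beta> r)"
proof -
  have I: "((\<lambda>s. Complex (\<alpha> s * \<delta> / 2) (- (\<beta> s * \<delta>) / 2)) has_integral fst (\<gamma> r) - fst (\<gamma> 0)) {0..r}"
    using horizontal_displacement(1)[OF hor, of 0 r] r by simp
  have "((\<lambda>s. \<alpha> s * \<delta> / 2) has_integral Re (fst (\<gamma> r) - fst (\<gamma> 0))) {0..r}"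
    using has_integral_linear[OF I bounded_linear_Re] by (simp add: o_def)
  from has_integral_mult_right[OF this, of "2 / \<delta>"]
  have a: "(\<alpha> has_integral 2 / \<delta> * Re (fst (\<gamma> r) - fst (\<gamma> 0))) {0..r}"
    using \<delta> by (simp add: field_simps)
  have "((\<lambda>s. - (\<beta> s * \<delta>) / 2) has_integral Im (fst (\<gamma> r) - fst (\<gamma> 0))) {0..r}"
    using has_integral_linear[OF I bounded_linear_Im] by (simp add: o_def)
  from has_integral_mult_right[OF this, of "- 2 / \<delta>"]
  have b: "(\<beta> has_integral - 2 / \<delta> * Im (fst (\<gamma> r) - fst (\<gamma> 0))) {0..r}"
    using \<delta> by (simp add: field_simps)
  show "\<alpha> integrable_on {0..r}" "\<beta> integrable_on {0..r}" using a b by blast+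
  show "fst (\<gamma> r) = Complex (loop_x (fst (\<gamma> 0)) \<delta> \<alpha> r) (loop_y (fst (\<gamma> 0)) \<delta> \<beta> r)"
    using integral_unique[OF a] integral_unique[OF b] \<delta>
    by (simp add: complex_eq_iff loop_x_def loop_y_def, simp add: field_simps)
qed

text \<open>\<open>Lambda_path\<close> is the height gained by the horizontal lift, also for controls that do not
  close up.\<close>

lemma Lambda_path_eq_displacement:
  assumes ctrl: "(\<alpha>, \<beta>) \<in> unit_controls" and \<delta>: "\<delta> \<noteq> 0"
    and hor: "horizontal P (\<lambda>s. \<alpha> s * \<delta>) (\<lambda>s. \<beta> s * \<delta>) \<gamma>"
  shows "Lambda_path P (fst (\<gamma> 0)) \<delta> \<alpha> \<beta> = snd (\<gamma> 1) - snd (\<gamma> 0)"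
    and "((\<lambda>s. \<delta> / 2 *
        (\<alpha> s * partial_y P (Complex (loop_x (fst (\<gamma> 0)) \<delta> \<alpha> s) (loop_y (fst (\<gamma> 0)) \<delta> \<beta> s)) +
         \<beta> s * partial_x P (Complex (loop_x (fst (\<gamma> 0)) \<delta> \<alpha> s) (loop_y (fst (\<gamma> 0)) \<delta> \<beta> s))))
      has_integral snd (\<gamma> 1) - snd (\<gamma> 0)) {0..1}" (is "(?g has_integral _) _")
proof -
  have ab: "\<alpha> \<in> FPWS" "\<beta> \<in> FPWS" using ctrl by (auto simp: unit_controls_def)
  obtain F where F: "finite F" "0 \<in> F" "1 \<in> F" "\<And>s. s \<in> {0..1} - F \<Longrightarrow> isCont \<alpha> s"
    by (rule FPWS_isCont[OF ab(1)]) blast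
  obtain G where G: "finite G" "0 \<in> G" "1 \<in> G" "\<And>s. s \<in> {0..1} - G \<Longrightarrow> isCont \<beta> s"
    by (rule FPWS_isCont[OF ab(2)]) blast
  show I: "(?g has_integral snd (\<gamma> 1) - snd (\<gamma> 0)) {0..1}"
  proof (rule has_integral_eq[OF _ horizontal_displacement(2)[OF hor]])
    fix s :: real assume "s \<in> {0..1}"
    from horizontal_fst_loop(3)[OF hor this \<delta>]
    show "(\<alpha> s * \<delta> * partial_y P (fst (\<gamma> s)) + \<beta> s * \<delta> * partial_x P (fst (\<gamma> s))) / 2 = ?g s"
      by (simp add: field_simps)
  qed auto
  have der: "deriv (\<lambda>r. c + k * integral {0..r} g) s = k * g s"
    if "g integrable_on {0..1}" "isCont g s" "s \<in> {0<..<1}" for g and s c k :: real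
  proof -
    have "((\<lambda>r. integral {0..r} g) has_vector_derivative g s) (at s within {0..1})"
      using integral_has_vector_derivative_continuous_at[OF that(1), of s "{}"] that(2,3)
      by (auto simp: continuous_at_imp_continuous_at_within)
    then have "((\<lambda>r. integral {0..r} g) has_field_derivative g s) (at s)"
      using that(3) at_within_Icc_at[of 0 s 1]
      by (simp add: has_real_derivative_iff_has_vector_derivative)
    then have "((\<lambda>r. c + k * integral {0..r} g) has_field_derivative k * g s) (at s)"
      by (auto intro!: derivative_eq_intros)
    then show ?thesis by (rule DERIV_imp_deriv)
  qed
  have int: "\<alpha> integrable_on {0..1}" "\<beta> integrable_on {0..1}"
    using horizontal_fst_loop(1,2)[OF hor _ \<delta>, of 1] by auto
  have "deriv (loop_x (fst (\<gamma> 0)) \<delta> \<alpha>) s = \<delta> / 2 * \<alpha> s"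
    "deriv (loop_y (fst (\<gamma> 0)) \<delta> \<beta>) s = - \<delta> / 2 * \<beta> s" if s: "s \<in> {0..1} - (F \<union> G)" for s
  proof -
    have s': "s \<in> {0<..<1}" using s F by (cases "s = 0"; cases "s = 1") auto
    have eq: "loop_x (fst (\<gamma> 0)) \<delta> \<alpha> = (\<lambda>r. Re (fst (\<gamma> 0)) + \<delta> / 2 * integral {0..r} \<alpha>)"
      "loop_y (fst (\<gamma> 0)) \<delta> \<beta> = (\<lambda>r. Im (fst (\<gamma> 0)) + (- \<delta> / 2) * integral {0..r} \<beta>)"
      by (auto simp: loop_x_def loop_y_def)
    show "deriv (loop_x (fst (\<gamma> 0)) \<delta> \<alpha>) s = \<delta> / 2 * \<alpha> s"
      unfolding eq by (rule der[OF int(1) F(4) s']) (use s in auto)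
    show "deriv (loop_y (fst (\<gamma> 0)) \<delta> \<beta>) s = - \<delta> / 2 * \<beta> s"
      unfolding eq by (rule der[OF int(2) G(4) s']) (use s in auto)
  qed
  then have "Lambda_path P (fst (\<gamma> 0)) \<delta> \<alpha> \<beta> = integral {0..1} ?g"
    unfolding Lambda_path_def
    by (intro integral_spike[OF negligible_finite, of "F \<union> G"]) (use F G in \<open>auto simp: algebra_simps\<close>)
  then show "Lambda_path P (fst (\<gamma> 0)) \<delta> \<alpha> \<beta> = snd (\<gamma> 1) - snd (\<gamma> 0)"
    using integral_unique[OF I] by simp
qed

lemma Lambda_path_eq_integral:
  assumes ctrl: "(\<alpha>, \<beta>) \<in> unit_controls" and \<delta>: "\<delta> \<noteq> 0"
  shows "((\<lambda>s. \<delta> / 2 * (\<alpha> s * partial_y P (Complex (loop_x z \<delta> \<alpha> s) (loop_y z \<delta> \<beta> s)) +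
         \<beta> s * partial_x P (Complex (loop_x z \<delta> \<alpha> s) (loop_y z \<delta> \<beta> s))))
      has_integral Lambda_path P z \<delta> \<alpha> \<beta>) {0..1}"
proof -
  obtain \<gamma> where \<gamma>: "\<gamma> 0 = (z, 0)" "horizontal P (\<lambda>s. \<alpha> s * \<delta>) (\<lambda>s. \<beta> s * \<delta>) \<gamma>"
    using unit_controls_horizontal_exists[OF ctrl, of "(z, 0)" \<delta>] by blast
  from Lambda_path_eq_displacement[OF ctrl \<delta> \<gamma>(2)] show ?thesis
    using \<gamma>(1) by simp
qed

text \<open>This translates between the supremum defining \<open>Lambda\<close> and the relation \<open>reach\<close>.\<close>

lemma reach_vertical_iff:
  assumes \<delta>: "0 < \<delta>"
  shows "reach P \<delta> (z, t) (z, t + h) \<longleftrightarrow> (\<exists>(\<alpha>, \<beta>)\<in>X_star. Lambda_path P z \<delta> \<alpha> \<beta> = h)"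
proof
  assume "reach P \<delta> (z, t) (z, t + h)"
  then obtain \<alpha> \<beta> \<gamma> where ctrl: "(\<alpha>, \<beta>) \<in> unit_controls"
    and hor: "horizontal P (\<lambda>s. \<alpha> s * \<delta>) (\<lambda>s. \<beta> s * \<delta>) \<gamma>" and ends: "\<gamma> 0 = (z, t)" "\<gamma> 1 = (z, t + h)"
    by (rule reachE) blast
  have "\<delta> \<noteq> 0" using \<delta> by simp
  have "(\<alpha>, \<beta>) \<in> X_star"
    using horizontal_fst_loop(3)[OF hor _ \<open>\<delta> \<noteq> 0\<close>, of 1] ends ctrl \<delta>
    by (auto simp: X_star_def unit_controls_def complex_eq_iff loop_x_def loop_y_def)
  moreover have "Lambda_path P z \<delta> \<alpha> \<beta> = h"
    using Lambda_path_eq_displacement(1)[OF ctrl \<open>\<delta> \<noteq> 0\<close> hor] ends by simp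
  ultimately show "\<exists>(\<alpha>, \<beta>)\<in>X_star. Lambda_path P z \<delta> \<alpha> \<beta> = h" by blast
next
  assume "\<exists>(\<alpha>, \<beta>)\<in>X_star. Lambda_path P z \<delta> \<alpha> \<beta> = h"
  then obtain \<alpha> \<beta> where X: "(\<alpha>, \<beta>) \<in> X_star" and h: "Lambda_path P z \<delta> \<alpha> \<beta> = h" by blast
  have ctrl: "(\<alpha>, \<beta>) \<in> unit_controls" by (rule X_star_unit_controls[OF X])
  have "\<delta> \<noteq> 0" using \<delta> by simp
  obtain \<gamma> where start: "\<gamma> 0 = (z, t)" and hor: "horizontal P (\<lambda>s. \<alpha> s * \<delta>) (\<lambda>s. \<beta> s * \<delta>) \<gamma>"
    using unit_controls_horizontal_exists[OF ctrl, of "(z, t)" \<delta>] by blast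
  have "fst (\<gamma> 1) = z"
    using horizontal_fst_loop(3)[OF hor _ \<open>\<delta> \<noteq> 0\<close>, of 1] start X
    by (simp add: X_star_def complex_eq_iff loop_x_def loop_y_def)
  moreover have "snd (\<gamma> 1) = t + h"
    using Lambda_path_eq_displacement(1)[OF ctrl \<open>\<delta> \<noteq> 0\<close> hor] start h by simp
  ultimately have "\<gamma> 1 = (z, t + h)" by (simp add: prod_eq_iff)
  from reachI[OF ctrl hor start this] show "reach P \<delta> (z, t) (z, t + h)" .
qed

lemma loop_in_cball:
  assumes ctrl: "(\<alpha>, \<beta>) \<in> unit_controls" and \<delta>: "0 < \<delta>" and s: "s \<in> {0..1}" and l: "\<bar>l\<bar> \<le> 1"
  shows "Complex (loop_x z \<delta> (\<lambda>s. l * \<alpha> s) s) (loop_y z \<delta> (\<lambda>s. l * \<beta> s) s) \<in> cball z \<delta>"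
proof -
  have "\<bar>integral {0..s} g\<bar> \<le> 1"
    if g: "\<And>s. s \<in> {0..1} \<Longrightarrow> \<bar>g s\<bar> \<le> 1" for g :: "real \<Rightarrow> real"
  proof (cases "g integrable_on {0..s}")
    case True
    then have I: "(g has_integral integral {0..s} g) (cbox 0 s)"
      by (simp add: integrable_integral)
    have "norm (integral {0..s} g) \<le> 1 * measure lborel (cbox 0 s)"
      by (rule has_integral_bound[OF _ I]) (use g s in auto)
    then show ?thesis using s by simp
  qed (simp add: not_integrable_integral)
  then have "\<bar>integral {0..s} \<alpha>\<bar> \<le> 1" "\<bar>integral {0..s} \<beta>\<bar> \<le> 1"
    using unit_controls_bound[OF ctrl] by blast+
  then have "\<bar>\<delta> / 2 * (l * integral {0..s} \<alpha>)\<bar> \<le> \<delta> / 2" "\<bar>\<delta> / 2 * (l * integral {0..s} \<beta>)\<bar> \<le> \<delta> / 2"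
    using \<delta> l by (auto simp: abs_mult intro!: mult_le_one)
  then show ?thesis
    using cmod_le[of "Complex (loop_x z \<delta> (\<lambda>s. l * \<alpha> s) s) (loop_y z \<delta> (\<lambda>s. l * \<beta> s) s) - z"]
    by (simp add: dist_norm norm_minus_commute loop_x_def loop_y_def)
qed

text \<open>The supremum defining \<open>Lambda\<close> is a conditionally complete one, so a bound must be known
  before it can be compared with its elements.\<close>

lemma Lambda_path_bounded:
  assumes \<delta>: "0 < \<delta>"
  obtains M where "\<And>\<alpha> \<beta>. (\<alpha>, \<beta>) \<in> unit_controls \<Longrightarrow> \<bar>Lambda_path P z \<delta> \<alpha> \<beta>\<bar> \<le> M"
proof -
  obtain M where M: "0 \<le> M" "\<And>w. w \<in> cball z \<delta> \<Longrightarrow> \<bar>partial_x P w\<bar> \<le> M"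
    "\<And>w. w \<in> cball z \<delta> \<Longrightarrow> \<bar>partial_y P w\<bar> \<le> M"
    by (rule partials_bounded_on_compact[OF compact_cball[of z \<delta>]]) blast
  have "\<bar>Lambda_path P z \<delta> \<alpha> \<beta>\<bar> \<le> \<delta> * M" if ctrl: "(\<alpha>, \<beta>) \<in> unit_controls" for \<alpha> \<beta>
  proof -
    let ?z = "\<lambda>s. Complex (loop_x z \<delta> \<alpha> s) (loop_y z \<delta> \<beta> s)"
    let ?g = "\<lambda>s. \<delta> / 2 * (\<alpha> s * partial_y P (?z s) + \<beta> s * partial_x P (?z s))"
    have g: "norm (?g s) \<le> \<delta> * M" if s: "s \<in> {0..1}" for s
    proof -
      have "?z s \<in> cball z \<delta>" using loop_in_cball[OF ctrl \<delta> s, of 1] by simp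
      note Ms = M(2,3)[OF this]
      have "\<bar>\<alpha> s * partial_y P (?z s)\<bar> \<le> 1 * M" "\<bar>\<beta> s * partial_x P (?z s)\<bar> \<le> 1 * M"
        unfolding abs_mult using Ms unit_controls_bound[OF ctrl s] M(1) by (intro mult_mono; simp)+
      then have "\<bar>\<alpha> s * partial_y P (?z s) + \<beta> s * partial_x P (?z s)\<bar> \<le> 2 * M" by linarith
      then have "\<delta> / 2 * \<bar>\<alpha> s * partial_y P (?z s) + \<beta> s * partial_x P (?z s)\<bar> \<le> \<delta> / 2 * (2 * M)"
        using \<delta> by (intro mult_left_mono) auto
      then show ?thesis using \<delta> by (simp add: abs_mult)
    qed
    have "(?g has_integral Lambda_path P z \<delta> \<alpha> \<beta>) (cbox 0 1)"
      using Lambda_path_eq_integral[OF ctrl] \<delta> by (simp add: cbox_interval)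
    from has_integral_bound[OF _ this, of "\<delta> * M"] g \<delta> M(1)
    show ?thesis by (simp add: cbox_interval)
  qed
  then show thesis by (rule that)
qed

lemma X_star_scale:
  assumes X: "(\<alpha>, \<beta>) \<in> X_star" and l: "\<bar>l\<bar> \<le> 1"
  shows "((\<lambda>s. l * \<alpha> s), (\<lambda>s. l * \<beta> s)) \<in> X_star"
proof -
  have l2: "l\<^sup>2 \<le> 1" using l by (simp add: abs_square_le_1)
  have "\<bar>l * \<alpha> s\<bar>\<^sup>2 + \<bar>l * \<beta> s\<bar>\<^sup>2 < 1" if "s \<in> {0..1}" for s
  proof -
    have "\<bar>l * \<alpha> s\<bar>\<^sup>2 + \<bar>l * \<beta> s\<bar>\<^sup>2 = l\<^sup>2 * (\<bar>\<alpha> s\<bar>\<^sup>2 + \<bar>\<beta> s\<bar>\<^sup>2)"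
      by (simp add: power_mult_distrib algebra_simps)
    also have "\<dots> \<le> 1 * (\<bar>\<alpha> s\<bar>\<^sup>2 + \<bar>\<beta> s\<bar>\<^sup>2)" using l2 by (intro mult_right_mono) auto
    also have "\<dots> < 1" using X that by (auto simp: X_star_def)
    finally show ?thesis .
  qed
  then show ?thesis using X by (auto simp: X_star_def FPWS_cmult)
qed

text \<open>The controls need not be continuous in the integration variable, so continuity in the scaling
  parameter comes from dominated convergence: all scaled loops stay in one disc, where the partial
  derivatives of \<open>P\<close> are bounded.\<close>

lemma Lambda_path_scale_continuous:
  assumes X: "(\<alpha>, \<beta>) \<in> X_star" and \<delta>: "0 < \<delta>"
  shows "continuous_on {0..1} (\<lambda>l. Lambda_path P z \<delta> (\<lambda>s. l * \<alpha> s) (\<lambda>s. l * \<beta> s))"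
proof -
  let ?z = "\<lambda>l s. Complex (loop_x z \<delta> (\<lambda>s. l * \<alpha> s) s) (loop_y z \<delta> (\<lambda>s. l * \<beta> s) s)"
  let ?g = "\<lambda>l s. \<delta> / 2 * (l * \<alpha> s * partial_y P (?z l s) + l * \<beta> s * partial_x P (?z l s))"
  have ctrl: "(\<alpha>, \<beta>) \<in> unit_controls" by (rule X_star_unit_controls[OF X])
  obtain M where M: "0 \<le> M" "\<And>w. w \<in> cball z \<delta> \<Longrightarrow> \<bar>partial_x P w\<bar> \<le> M"
    "\<And>w. w \<in> cball z \<delta> \<Longrightarrow> \<bar>partial_y P w\<bar> \<le> M"
    by (rule partials_bounded_on_compact[OF compact_cball[of z \<delta>]]) blast
  have int: "(?g l has_integral Lambda_path P z \<delta> (\<lambda>s. l * \<alpha> s) (\<lambda>s. l * \<beta> s)) {0..1}"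
    if "l \<in> {0..1}" for l
    using Lambda_path_eq_integral[OF X_star_unit_controls[OF X_star_scale[OF X]], of l \<delta> z] that \<delta> by simp
  have bound: "norm (?g l s) \<le> \<delta> * M" if l: "l \<in> {0..1}" and s: "s \<in> {0..1}" for l s
  proof -
    have lab: "\<bar>l * \<alpha> s\<bar> \<le> 1" "\<bar>l * \<beta> s\<bar> \<le> 1"
      unfolding abs_mult using l unit_controls_bound[OF ctrl s] by (auto intro!: mult_le_one)
    have "?z l s \<in> cball z \<delta>" using loop_in_cball[OF ctrl \<delta> s, of l] l by simp
    note Ms = M(2,3)[OF this]
    have "\<bar>(l * \<alpha> s) * partial_y P (?z l s)\<bar> \<le> 1 * M" "\<bar>(l * \<beta> s) * partial_x P (?z l s)\<bar> \<le> 1 * M"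
      unfolding abs_mult[of _ "partial_y P _"] abs_mult[of _ "partial_x P _"]
      using Ms lab M(1) by (intro mult_mono; simp)+
    then have "\<bar>l * \<alpha> s * partial_y P (?z l s) + l * \<beta> s * partial_x P (?z l s)\<bar> \<le> 2 * M" by linarith
    then have "\<delta> / 2 * \<bar>l * \<alpha> s * partial_y P (?z l s) + l * \<beta> s * partial_x P (?z l s)\<bar> \<le> \<delta> / 2 * (2 * M)"
      using \<delta> by (intro mult_left_mono) auto
    then show ?thesis using \<delta> by (simp add: abs_mult)
  qed
  have cont: "continuous_on UNIV (\<lambda>l. ?g l s)" for s
    unfolding loop_x_def loop_y_def integral_mult_right Complex_eq
    by (intro continuous_intros continuous_on_compose2[OF continuous_partial_x]
        continuous_on_compose2[OF continuous_partial_y]) auto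
  show ?thesis
    unfolding continuous_on_sequentially
  proof (intro allI ballI impI, elim conjE)
    fix x and l :: real assume x: "\<forall>n. x n \<in> {0..1::real}" and l: "l \<in> {0..1}" and lim: "x \<longlonglongrightarrow> l"
    have conv: "(\<lambda>n. ?g (x n) s) \<longlonglongrightarrow> ?g l s" for s
      using cont[of s] lim unfolding continuous_on_sequentially by (auto simp: o_def)
    have "(\<lambda>n. integral {0..1} (?g (x n))) \<longlonglongrightarrow> integral {0..1} (?g l)"
    proof (rule dominated_convergence(2)[where h = "\<lambda>_. \<delta> * M"])
      show "?g (x n) integrable_on {0..1}" for n
        using int[of "x n"] x by (blast intro: has_integral_integrable)
      show "norm (?g (x n) s) \<le> \<delta> * M" if "s \<in> {0..1}" for n s
        by (rule bound) (use x that in auto)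
      show "(\<lambda>n. ?g (x n) s) \<longlonglongrightarrow> ?g l s" for s
        by (rule conv)
    qed (rule integrable_const_ivl)
    moreover have "integral {0..1} (?g l) = Lambda_path P z \<delta> (\<lambda>s. l * \<alpha> s) (\<lambda>s. l * \<beta> s)"
      if "l \<in> {0..1}" for l
      using int[OF that] by (rule integral_unique)
    ultimately show "((\<lambda>l. Lambda_path P z \<delta> (\<lambda>s. l * \<alpha> s) (\<lambda>s. l * \<beta> s)) \<circ> x)
        \<longlonglongrightarrow> Lambda_path P z \<delta> (\<lambda>s. l * \<alpha> s) (\<lambda>s. l * \<beta> s)"
      using x l by (simp add: o_def)
  qed
qed

lemma abs_displacement_le_Lambda:
  assumes \<delta>: "0 < \<delta>" and r: "reach P \<delta> (z, t) (z, t + h)"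
  shows "\<bar>h\<bar> \<le> Lambda P (z, t') \<delta>"
proof -
  obtain \<alpha> \<beta> where X: "(\<alpha>, \<beta>) \<in> X_star" and h: "Lambda_path P z \<delta> \<alpha> \<beta> = h"
    using r reach_vertical_iff[OF \<delta>] by blast
  obtain M where M: "\<And>\<alpha> \<beta>. (\<alpha>, \<beta>) \<in> unit_controls \<Longrightarrow> \<bar>Lambda_path P z \<delta> \<alpha> \<beta>\<bar> \<le> M"
    by (rule Lambda_path_bounded[OF \<delta>]) blast
  have "bdd_above ((\<lambda>(\<alpha>, \<beta>). \<bar>Lambda_path P z \<delta> \<alpha> \<beta>\<bar>) ` X_star)"
    by (rule bdd_aboveI[of _ M]) (auto dest: X_star_unit_controls M)
  from cSUP_upper[OF X this] show ?thesis using h by (simp add: Lambda_def)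
qed

text \<open>Scaling a loop from the constant one to a loop with larger displacement attains \<open>\<bar>h\<bar>\<close> by
  the intermediate value theorem. The sign is corrected by running the loop backwards.\<close>

lemma reach_vertical_of_less_Lambda:
  assumes \<delta>: "0 < \<delta>" and h: "\<bar>h\<bar> < Lambda P (z, t') \<delta>"
  shows "reach P \<delta> (z, t) (z, t + h)"
proof -
  have "((\<lambda>_. 0), (\<lambda>_. 0)) \<in> X_star" by (simp add: X_star_def FPWS_const)
  then have "X_star \<noteq> {}" by blast
  then obtain \<alpha> \<beta> where X: "(\<alpha>, \<beta>) \<in> X_star" and gt: "\<bar>h\<bar> < \<bar>Lambda_path P z \<delta> \<alpha> \<beta>\<bar>"
    using h less_cSupD[of "(\<lambda>(\<alpha>, \<beta>). \<bar>Lambda_path P z \<delta> \<alpha> \<beta>\<bar>) ` X_star" "\<bar>h\<bar>"]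
    by (auto simp: Lambda_def)
  define A where "A l = Lambda_path P z \<delta> (\<lambda>s. l * \<alpha> s) (\<lambda>s. l * \<beta> s)" for l
  have cont: "continuous_on {0..1} (\<lambda>l. \<bar>A l\<bar>)"
    unfolding A_def by (intro continuous_intros Lambda_path_scale_continuous[OF X \<delta>])
  have "A 0 = 0" using Lambda_path_eq_integral[OF X_star_unit_controls[OF X_star_scale[OF X]], of 0 \<delta> z] \<delta>
    by (simp add: A_def has_integral_0_eq)
  moreover have "A 1 = Lambda_path P z \<delta> \<alpha> \<beta>" by (simp add: A_def)
  ultimately obtain l where l: "0 \<le> l" "l \<le> 1" "\<bar>A l\<bar> = \<bar>h\<bar>"
    using IVT'[OF _ _ _ cont, of "\<bar>h\<bar>"] gt by auto
  have "((\<lambda>s. l * \<alpha> s), (\<lambda>s. l * \<beta> s)) \<in> X_star" using X_star_scale[OF X] l by simp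
  then have r: "reach P \<delta> (z, t) (z, t + A l)" for t
    unfolding reach_vertical_iff[OF \<delta>] A_def by blast
  consider "A l = h" | "A l = - h" using l(3) by linarith
  then show ?thesis
  proof cases
    case 1 then show ?thesis using r by simp
  next
    case 2 then show ?thesis using reach_reverse[OF r[of "t + h"]] by simp
  qed
qed

lemma Lambda_nonneg: "0 < \<delta> \<Longrightarrow> 0 \<le> Lambda P (z, t) \<delta>"
  using abs_displacement_le_Lambda[of \<delta> z 0 0 t] reach_refl[of P \<delta> "(z, 0)"] by simp

text \<open>Repeating a loop \<open>n + 1\<close> times multiplies both its size and its displacement by \<open>n + 1\<close>.\<close>

lemma Lambda_superadditive:
  assumes \<delta>: "0 < \<delta>"
  shows "real (Suc n) * Lambda P (z, t) \<delta> \<le> Lambda P (z, t') (real (Suc n) * \<delta>)"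
proof -
  have pos: "0 < real (Suc n) * \<delta>" using \<delta> by simp
  have "h \<le> Lambda P (z, t') (real (Suc n) * \<delta>) / real (Suc n)" if "h < Lambda P (z, t) \<delta>" for h
  proof (cases "0 \<le> h")
    case True
    have "reach P \<delta> (z, 0) (z, 0 + h)"
      by (rule reach_vertical_of_less_Lambda[OF \<delta>, of _ _ t]) (use True that in simp)
    then have "reach P \<delta> (z, 0) ((z, 0) + (0, h))" by simp
    from reach_vertical_iterate[OF \<delta> this, of n]
    have "reach P (real (Suc n) * \<delta>) (z, 0) (z, 0 + real (Suc n) * h)" by simp
    from abs_displacement_le_Lambda[OF pos this, of t']
    have "real (Suc n) * h \<le> Lambda P (z, t') (real (Suc n) * \<delta>)" by linarith
    then show ?thesis by (simp add: field_simps)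
  next
    case False
    have "0 \<le> Lambda P (z, t') (real (Suc n) * \<delta>) / real (Suc n)"
      using Lambda_nonneg[OF pos] by simp
    then show ?thesis using False by linarith
  qed
  then have "Lambda P (z, t) \<delta> \<le> Lambda P (z, t') (real (Suc n) * \<delta>) / real (Suc n)"
    by (rule dense_le)
  then show ?thesis by (simp add: field_simps)
qed

section \<open>Exponentials and cylinders\<close>

text \<open>Since \<open>field_T\<close> is constant and the fields \<open>X\<close>, \<open>Y\<close> do not see the height, adding or removing
  the linear height \<open>c * s\<close> turns the integral curves of the combined field into the horizontal
  curves with constant controls, and conversely. Existence and uniqueness are inherited.\<close>

lemma exp_field_combination:
  obtains \<gamma> where "horizontal P (\<lambda>_. a) (\<lambda>_. b) \<gamma>" "\<gamma> 0 = p"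
    "exp_field (\<lambda>p. a *\<^sub>R field_X P p + b *\<^sub>R field_Y P p + c *\<^sub>R field_T p) p = \<gamma> 1 + (0, c)"
proof -
  let ?W = "\<lambda>p. a *\<^sub>R field_X P p + b *\<^sub>R field_Y P p"
  let ?V = "\<lambda>p. ?W p + c *\<^sub>R field_T p"
  have shift: "?W (p + (0, h)) = ?W p" for p h unfolding horizontal_velocity by simp
  have T: "c *\<^sub>R field_T q = (0, c)" for q by (simp add: field_T_def)
  have vert: "((\<lambda>s. (0, k * s)) has_vector_derivative (0::complex, k)) (at x within S)"
    for k x :: real and S
    by (rule has_vector_derivative_Pair) (auto intro!: derivative_eq_intros)
  obtain \<gamma> where \<gamma>: "\<gamma> 0 = p" "continuous_on {0..1} \<gamma>"
    and der: "\<forall>s\<in>{0..1}. (\<gamma> has_vector_derivative ?W (\<gamma> s)) (at s within {0..1})"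
    using horizontal_exists[of "{}" "\<lambda>_. a" "\<lambda>_. b" "max \<bar>a\<bar> \<bar>b\<bar>" p] by auto
  have Icc: "at s within {0..1} = at s" if "s \<in> {0<..<1}" for s :: real
    using that by (intro at_within_Icc_at) auto
  have hor: "horizontal P (\<lambda>_. a) (\<lambda>_. b) \<sigma>"
    if "\<forall>s\<in>{0..1}. (\<sigma> has_vector_derivative ?W (\<sigma> s)) (at s within {0..1})" for \<sigma>
    unfolding horizontal_def
  proof (intro conjI exI[of _ "{}"] ballI)
    show "continuous_on {0..1} \<sigma>"
      by (rule continuous_on_vector_derivative) (use that in blast)
    fix s :: real assume "s \<in> {0<..<1} - {}"
    then show "(\<sigma> has_vector_derivative ?W (\<sigma> s)) (at s)"
      using that[rule_format, of s] Icc[of s] by simp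
  qed simp
  have "integral_curve ?V p (\<lambda>s. \<gamma> s + (0, c * s))"
    unfolding integral_curve_def shift T
  proof (intro conjI ballI)
    show "\<gamma> 0 + (0, c * 0) = p" using \<gamma>(1) by (simp add: prod_eq_iff)
    show "((\<lambda>s. \<gamma> s + (0, c * s)) has_vector_derivative ?W (\<gamma> s) + (0, c)) (at s within {0..1})"
      if "s \<in> {0..1}" for s
      by (rule has_vector_derivative_add[OF der[rule_format, OF that] vert])
  qed
  moreover have "\<sigma> 1 = \<gamma> 1 + (0, c)" if "integral_curve ?V p \<sigma>" for \<sigma>
  proof -
    define \<tau> where "\<tau> s = \<sigma> s + (0, (- c) * s)" for s
    have "(\<tau> has_vector_derivative ?W (\<tau> s)) (at s within {0..1})" if s: "s \<in> {0..1}" for s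
    proof -
      have "(\<sigma> has_vector_derivative ?W (\<sigma> s) + (0, c)) (at s within {0..1})"
        using \<open>integral_curve ?V p \<sigma>\<close> s by (simp add: integral_curve_def T)
      from has_vector_derivative_add[OF this vert[of "- c"]]
      moreover have "?W q + (0, c) + (0, - c) = ?W q" for q by (simp add: prod_eq_iff)
      ultimately show ?thesis unfolding \<tau>_def shift by (simp only:)
    qed
    then have "horizontal P (\<lambda>_. a) (\<lambda>_. b) \<tau>" by (intro hor ballI)
    moreover have "\<tau> 0 = \<gamma> 0"
      using that \<gamma>(1) by (simp add: \<tau>_def integral_curve_def prod_eq_iff)
    ultimately have "\<tau> 1 = \<gamma> 1" using horizontal_unique[OF _ hor[OF der], of \<tau> 1] by simp
    then have "\<sigma> 1 + (0, - c) + (0, c) = \<gamma> 1 + (0, c)" by (simp add: \<tau>_def)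
    then show ?thesis by (simp add: prod_eq_iff)
  qed
  ultimately have "exp_field ?V p = \<gamma> 1 + (0, c)"
    unfolding exp_field_def
  proof (intro the_equality exI conjI)
    show "\<gamma> 1 + (0, c * 1) = \<gamma> 1 + (0, c)" by simp
  qed blast+
  with hor[OF der] \<gamma>(1) show thesis by (rule that)
qed

text \<open>A cylinder consists of the vertical segments of half-height \<open>f e\<close> centred at the ends of the
  lifted straight segments.\<close>

lemma mem_Cyl_iff:
  "q \<in> Cyl P f p e \<longleftrightarrow> (\<exists>a b c \<gamma>. a\<^sup>2 + b\<^sup>2 < 1 \<and> \<bar>c\<bar> < 1 \<and>
     horizontal P (\<lambda>_. a * e) (\<lambda>_. b * e) \<gamma> \<and> \<gamma> 0 = p \<and> q = \<gamma> 1 + (0, c * f e))"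
  (is "_ \<longleftrightarrow> (\<exists>a b c \<gamma>. ?R a b c \<gamma>)")
proof
  assume "q \<in> Cyl P f p e"
  then obtain a b c where ab: "a\<^sup>2 + b\<^sup>2 < 1" and c: "- 1 < c" "c < 1" and q: "q = Psi P f p e ((a, b), c)"
    unfolding Cyl_def by auto
  obtain \<gamma> where "horizontal P (\<lambda>_. a * e) (\<lambda>_. b * e) \<gamma>" "\<gamma> 0 = p"
    "exp_field (\<lambda>p. (a * e) *\<^sub>R field_X P p + (b * e) *\<^sub>R field_Y P p + (c * f e) *\<^sub>R field_T p) p
      = \<gamma> 1 + (0, c * f e)"
    by (rule exp_field_combination)
  then have "?R a b c \<gamma>" using ab c by (simp add: q Psi_def abs_less_iff)
  then show "\<exists>a b c \<gamma>. ?R a b c \<gamma>" by blast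
next
  assume "\<exists>a b c \<gamma>. ?R a b c \<gamma>"
  then obtain a b c \<gamma> where ab: "a\<^sup>2 + b\<^sup>2 < 1" and c: "\<bar>c\<bar> < 1"
    and \<gamma>: "horizontal P (\<lambda>_. a * e) (\<lambda>_. b * e) \<gamma>" "\<gamma> 0 = p" and q: "q = \<gamma> 1 + (0, c * f e)"
    by blast
  obtain \<sigma> where \<sigma>: "horizontal P (\<lambda>_. a * e) (\<lambda>_. b * e) \<sigma>" "\<sigma> 0 = p"
    and ex: "exp_field (\<lambda>p. (a * e) *\<^sub>R field_X P p + (b * e) *\<^sub>R field_Y P p + (c * f e) *\<^sub>R field_T p) p
      = \<sigma> 1 + (0, c * f e)"
    by (rule exp_field_combination)
  have "\<sigma> 1 = \<gamma> 1" using horizontal_unique[OF \<sigma>(1) \<gamma>(1), of 1] \<sigma>(2) \<gamma>(2) by simp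
  then have "q = Psi P f p e ((a, b), c)" using ex q by (simp add: Psi_def)
  then show "q \<in> Cyl P f p e" unfolding Cyl_def using ab c by (auto simp: abs_less_iff)
qed

section \<open>Comparison of cylinders and balls\<close>

lemma reach_horizontal_const:
  assumes hor: "horizontal P (\<lambda>_. a * \<delta>) (\<lambda>_. b * \<delta>) \<gamma>" and ab: "a\<^sup>2 + b\<^sup>2 < 1"
  shows "reach P \<delta> (\<gamma> 0) (\<gamma> 1)"
proof (rule reachI[OF _ hor])
  show "((\<lambda>_. a), (\<lambda>_. b)) \<in> unit_controls" using ab by (simp add: unit_controls_def FPWS_const)
qed auto

lemma reach_cmod_le:
  assumes r: "reach P \<delta> p q" and \<delta>: "0 < \<delta>"
  shows "cmod (fst q - fst p) \<le> \<delta> / 2"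
proof -
  obtain \<alpha> \<beta> \<gamma> where ctrl: "(\<alpha>, \<beta>) \<in> unit_controls"
    and hor: "horizontal P (\<lambda>s. \<alpha> s * \<delta>) (\<lambda>s. \<beta> s * \<delta>) \<gamma>" and ends: "\<gamma> 0 = p" "\<gamma> 1 = q"
    using r by (rule reachE) blast
  have I: "((\<lambda>s. Complex (\<alpha> s * \<delta> / 2) (- (\<beta> s * \<delta>) / 2)) has_integral fst q - fst p) (cbox 0 1)"
    using horizontal_displacement(1)[OF hor, of 0 1] ends by (simp add: cbox_interval)
  have "norm (Complex (\<alpha> s * \<delta> / 2) (- (\<beta> s * \<delta>) / 2)) \<le> \<delta> / 2" if "s \<in> cbox 0 1" for s
  proof -
    have "(\<alpha> s)\<^sup>2 + (\<beta> s)\<^sup>2 \<le> 1" using ctrl that by (force simp: unit_controls_def)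
    then have "sqrt ((\<alpha> s)\<^sup>2 + (\<beta> s)\<^sup>2) \<le> 1" by simp
    moreover have "Complex (\<alpha> s * \<delta> / 2) (- (\<beta> s * \<delta>) / 2) = of_real (\<delta> / 2) * Complex (\<alpha> s) (- \<beta> s)"
      by (simp add: complex_eq_iff)
    then have "norm (Complex (\<alpha> s * \<delta> / 2) (- (\<beta> s * \<delta>) / 2)) = \<delta> / 2 * sqrt ((\<alpha> s)\<^sup>2 + (\<beta> s)\<^sup>2)"
      using \<delta> by (simp only: norm_mult norm_of_real) (simp add: complex_norm)
    ultimately show ?thesis using \<delta> by (simp add: mult_left_le)
  qed
  from has_integral_bound[OF _ I this] \<delta> show ?thesis by (simp add: cbox_interval)
qed

text \<open>The straight part has size \<open>e\<close>, and the vertical part is split into \<open>n + 1\<close> equal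
  displacements, each zero or below \<open>Lambda\<close> and hence of size \<open>e\<close>.\<close>

lemma Cyl_subset_cc_ball:
  assumes e: "0 < e" and f0: "0 \<le> f e"
    and f: "\<And>p. f e \<le> real (Suc n) * Lambda P p e" and \<delta>: "real (Suc (Suc n)) * e < \<delta>"
  shows "Cyl P f p e \<subseteq> cc_ball P p \<delta>"
proof
  fix q assume "q \<in> Cyl P f p e"
  then obtain a b c \<gamma> where ab: "a\<^sup>2 + b\<^sup>2 < 1" and c: "\<bar>c\<bar> < 1"
    and \<gamma>: "horizontal P (\<lambda>_. a * e) (\<lambda>_. b * e) \<gamma>" "\<gamma> 0 = p" and q: "q = \<gamma> 1 + (0, c * f e)"
    unfolding mem_Cyl_iff by blast
  have r1: "reach P e p (\<gamma> 1)" using reach_horizontal_const[OF \<gamma>(1) ab] \<gamma>(2) by simp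
  define h where "h = c * f e / real (Suc n)"
  have "reach P e (\<gamma> 1) (\<gamma> 1 + (0, h))"
  \<comment> \<open>If \<open>f e = 0\<close> then \<open>Lambda\<close> may vanish too and no loop has a displacement to spare.\<close>
  proof (cases "f e = 0")
    case True
    then show ?thesis using reach_refl[of P e "\<gamma> 1"] by (simp add: h_def zero_prod_def[symmetric])
  next
    case False
    then have "\<bar>c * f e\<bar> < 1 * f e"
      unfolding abs_mult using c f0 by (intro mult_strict_right_mono[of "\<bar>c\<bar>" 1 "\<bar>f e\<bar>", THEN order.strict_trans2]) auto
    also have "\<dots> \<le> real (Suc n) * Lambda P (fst (\<gamma> 1), 0) e" using f by simp
    finally have "\<bar>h\<bar> < Lambda P (fst (\<gamma> 1), 0) e"
      by (simp add: h_def pos_divide_less_eq mult.commute del: of_nat_Suc)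
    from reach_vertical_of_less_Lambda[OF e this, of "snd (\<gamma> 1)"]
    show ?thesis by (metis add_Pair add.right_neutral prod.collapse)
  qed
  from reach_vertical_iterate[OF e this, of n]
  have "reach P (real (Suc n) * e) (\<gamma> 1) q" by (simp add: q h_def del: of_nat_Suc)
  from reach_trans[OF e _ r1 this] e
  have "reach P (e + real (Suc n) * e) p q" by simp
  then have "cc_admissible P p q (real (Suc (Suc n)) * e)"
    using reach_imp_cc_admissible by (simp add: algebra_simps)
  moreover have "0 < real (Suc (Suc n)) * e" using e by simp
  ultimately have "cc_dist P p q \<le> ereal (real (Suc (Suc n)) * e)"
    unfolding cc_dist_def by (intro INF_lower) (simp del: of_nat_Suc)
  also have "\<dots> < ereal \<delta>" using \<delta> by (simp del: of_nat_Suc)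
  finally show "q \<in> cc_ball P p \<delta>" by (simp add: cc_ball_def)
qed

text \<open>Closing the curve from \<open>p\<close> to \<open>q\<close> by the straight segment back to \<open>p\<close> bounds the vertical
  distance \<open>D\<close> from \<open>q\<close> to the lifted segment by \<open>Lambda P p (3 * \<delta>)\<close>. Enlarging the size by the
  factor \<open>n + 1 > C\<close> makes this at most the fraction \<open>C / (n + 1)\<close> of the value of \<open>f\<close>.\<close>

lemma cc_ball_subset_Cyl:
  assumes \<delta>: "0 < \<delta>" and C: "0 < C" "C < real (Suc n)"
    and f: "Lambda P p (real (Suc n) * (3 * \<delta>)) \<le> C * f (real (Suc n) * (3 * \<delta>))"
  shows "cc_ball P p \<delta> \<subseteq> Cyl P f p (real (Suc n) * (3 * \<delta>))"
proof
  fix q assume "q \<in> cc_ball P p \<delta>"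
  then obtain \<delta>' where "0 < \<delta>'" "\<delta>' < \<delta>" "cc_admissible P p q \<delta>'"
    by (auto simp: cc_ball_def cc_dist_def INF_less_iff)
  then have r1: "reach P \<delta> p q" using cc_admissible_imp_reach by blast
  define e where "e = real (Suc n) * (3 * \<delta>)"
  have e: "0 < e" "3 * \<delta> \<le> e" using \<delta> by (auto simp: e_def mult_le_cancel_right1)
  define w where "w = fst q - fst p"
  have w: "cmod w \<le> \<delta> / 2" unfolding w_def by (rule reach_cmod_le[OF r1 \<delta>])
  \<comment> \<open>The segment from \<open>p\<close> over \<open>w\<close> is used twice, with size \<open>2 * \<delta>\<close> for closing the loop and with
    size \<open>e\<close> as the axis of the cylinder.\<close>
  have small: "(k * Re w / d)\<^sup>2 + (- k * Im w / d)\<^sup>2 < 1" if "0 < d" "\<bar>k\<bar> * (\<delta> / 2) < d" for k d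
  proof -
    have "(k * Re w / d)\<^sup>2 + (- k * Im w / d)\<^sup>2 = (\<bar>k\<bar> * cmod w / d)\<^sup>2"
      by (simp add: cmod_def power_divide power_mult_distrib add_divide_distrib[symmetric] distrib_left)
    also have "\<dots> < 1"
    proof -
      have "\<bar>k\<bar> * cmod w \<le> \<bar>k\<bar> * (\<delta> / 2)" using w by (intro mult_left_mono) auto
      then have "\<bar>k\<bar> * cmod w / d < 1" using that by simp
      moreover have "0 \<le> \<bar>k\<bar> * cmod w / d" using that by simp
      ultimately show ?thesis by (simp add: abs_square_less_1)
    qed
    finally show ?thesis .
  qed
  obtain \<gamma> where \<gamma>: "horizontal P (\<lambda>_. 2 * Re w) (\<lambda>_. - 2 * Im w) \<gamma>" "\<gamma> 0 = p"
    using exp_field_combination[of "2 * Re w" "- 2 * Im w" p 0] by blast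
  have "fst (\<gamma> 1) - fst (\<gamma> 0) = w"
    using has_integral_unique[OF horizontal_displacement(1)[OF \<gamma>(1), of 0 1]]
      has_integral_const_real[of w 0 1] by (simp add: complex_surj)
  then have fst1: "fst (\<gamma> 1) = fst q" using \<gamma>(2) by (simp add: w_def)
  define D where "D = snd q - snd (\<gamma> 1)"
  have q: "q = \<gamma> 1 + (0, D)" using fst1 by (simp add: prod_eq_iff D_def)
  have "reach P (2 * \<delta>) (\<gamma> 0) (\<gamma> 1)"
    by (rule reach_horizontal_const[of "2 * Re w / (2 * \<delta>)" _ "- 2 * Im w / (2 * \<delta>)"])
       (use \<gamma>(1) \<delta> small[of "2 * \<delta>" 2] in \<open>auto simp: mult.commute\<close>)
  then have "reach P (2 * \<delta>) (\<gamma> 1) p" using reach_reverse \<gamma>(2) by auto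
  from reach_translate[OF this, of D] have "reach P (2 * \<delta>) q (p + (0, D))" by (simp add: q)
  from reach_trans[OF \<delta> _ r1 this] \<delta> have "reach P (3 * \<delta>) p (p + (0, D))" by simp
  then have "reach P (3 * \<delta>) (fst p, snd p) (fst p, snd p + D)"
    by (metis add_Pair add.right_neutral prod.collapse)
  from abs_displacement_le_Lambda[OF _ this, of "snd p"] \<delta>
  have "\<bar>D\<bar> \<le> Lambda P p (3 * \<delta>)" by simp
  then have "real (Suc n) * \<bar>D\<bar> \<le> real (Suc n) * Lambda P p (3 * \<delta>)" by (intro mult_left_mono) auto
  also have "\<dots> \<le> Lambda P p e"
    using Lambda_superadditive[of "3 * \<delta>" n "fst p" "snd p" "snd p"] \<delta> by (simp add: e_def del: of_nat_Suc)
  also have "\<dots> \<le> C * f e" using f by (simp add: e_def)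
  finally have D: "real (Suc n) * \<bar>D\<bar> \<le> C * f e" .
  have "0 \<le> C * f e" by (rule order_trans[OF _ D]) simp
  then have f0: "0 \<le> f e" using C(1) by (simp add: zero_le_mult_iff)
  have "\<exists>c. \<bar>c\<bar> < 1 \<and> D = c * f e"
  proof (cases "f e = 0")
    case True
    then have "real (Suc n) * \<bar>D\<bar> \<le> 0" using D by simp
    then have "D = 0" by (simp add: mult_le_0_iff del: of_nat_Suc)
    then show ?thesis by (intro exI[of _ 0]) simp
  next
    case False
    then have fpos: "0 < f e" using f0 by simp
    have "real (Suc n) * \<bar>D\<bar> < real (Suc n) * f e"
      using D mult_strict_right_mono[OF C(2) fpos] by linarith
    then have "\<bar>D\<bar> < f e" by (simp del: of_nat_Suc)
    then show ?thesis using fpos by (intro exI[of _ "D / f e"]) simp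
  qed
  then obtain c where c: "\<bar>c\<bar> < 1" "D = c * f e" by blast
  have "(2 * Re w / e)\<^sup>2 + (- 2 * Im w / e)\<^sup>2 < 1" by (rule small) (use e \<delta> in auto)
  moreover have "horizontal P (\<lambda>_. 2 * Re w / e * e) (\<lambda>_. - 2 * Im w / e * e) \<gamma>"
    using \<gamma>(1) e(1) by simp
  ultimately have "q \<in> Cyl P f p e"
    unfolding mem_Cyl_iff using c q \<gamma>(2) by blast
  then show "q \<in> Cyl P f p (real (Suc n) * (3 * \<delta>))" by (simp add: e_def)
qed

end

lemma smooth_plane_C1_potential:
  assumes "smooth_plane P"
  shows "C1_potential P"
proof
  have "class_C (Suc 0) P" using assms unfolding smooth_plane_def by blast
  then show "continuous_on UNIV (partial_x P)" "continuous_on UNIV (partial_y P)" by auto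
qed

theorem theorem5p1:
  fixes P :: "complex \<Rightarrow> real" and f :: "real \<Rightarrow> real" and \<delta>\<^sub>0 :: real
  assumes "smooth_plane P"
    and "subharmonic_plane P"
    and "\<not> harmonic_plane P"
    and "uniform_global_structure P f \<delta>\<^sub>0"
  shows "\<exists>r R. 0 < r \<and> r < R \<and>
    (\<forall>p0 \<delta>. \<delta>\<^sub>0 \<le> \<delta> \<longrightarrow>
       (\<delta>\<^sub>0 \<le> r * \<delta> \<longrightarrow> Cyl P f p0 (r * \<delta>) \<subseteq> cc_ball P p0 \<delta>) \<and>
       cc_ball P p0 \<delta> \<subseteq> Cyl P f p0 (R * \<delta>))"
proof -
  interpret C1_potential P using assms(1) by (rule smooth_plane_C1_potential)
  obtain C where \<delta>\<^sub>0: "0 < \<delta>\<^sub>0" and f0: "\<And>\<delta>. \<delta>\<^sub>0 \<le> \<delta> \<Longrightarrow> 0 \<le> f \<delta>" and C: "0 < C"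
    and \<Lambda>_le: "\<And>p \<delta>. \<delta>\<^sub>0 \<le> \<delta> \<Longrightarrow> Lambda P p \<delta> \<le> C * f \<delta>"
    and f_le: "\<And>p \<delta>. \<delta>\<^sub>0 \<le> \<delta> \<Longrightarrow> f \<delta> \<le> C * Lambda P p \<delta>"
    using assms(4) unfolding uniform_global_structure_def by blast
  obtain n where n: "C < real (Suc n)"
    using reals_Archimedean2[of C] by (metis less_trans of_nat_less_iff lessI)
  define r where "r = 1 / (real (Suc n) + 2)"
  define R where "R = real (Suc n) * 3"
  have "0 < r" "r < R"
  proof -
    show "0 < r" by (simp add: r_def)
    have "r < 1" by (simp add: r_def)
    then show "r < R" by (simp add: R_def)
  qed
  moreover have "Cyl P f p (r * \<delta>) \<subseteq> cc_ball P p \<delta>" if \<delta>: "\<delta>\<^sub>0 \<le> \<delta>" "\<delta>\<^sub>0 \<le> r * \<delta>" for p \<delta>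
  proof (rule Cyl_subset_cc_ball[where n = n])
    show "0 < r * \<delta>" "0 \<le> f (r * \<delta>)" using f0 \<delta> \<delta>\<^sub>0 by auto
    show "f (r * \<delta>) \<le> real (Suc n) * Lambda P p (r * \<delta>)" for p
    proof -
      have "0 \<le> Lambda P p (r * \<delta>)" using Lambda_nonneg[of "r * \<delta>" "fst p" "snd p"] \<delta> \<delta>\<^sub>0 by simp
      then have "C * Lambda P p (r * \<delta>) \<le> real (Suc n) * Lambda P p (r * \<delta>)"
        using n by (intro mult_right_mono) auto
      with f_le[OF \<delta>(2), of p] show ?thesis by linarith
    qed
    show "real (Suc (Suc n)) * (r * \<delta>) < \<delta>"
      using \<delta>(1) \<delta>\<^sub>0 by (simp add: r_def field_simps)
  qed
  moreover have "cc_ball P p \<delta> \<subseteq> Cyl P f p (R * \<delta>)" if \<delta>: "\<delta>\<^sub>0 \<le> \<delta>" for p \<delta>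
  proof -
    have R: "real (Suc n) * (3 * \<delta>) = R * \<delta>" by (simp add: R_def)
    have "1 * \<delta> \<le> R * \<delta>" using \<delta> \<delta>\<^sub>0 by (intro mult_right_mono) (auto simp: R_def)
    then have "\<delta>\<^sub>0 \<le> R * \<delta>" using \<delta> by simp
    then show ?thesis
      using cc_ball_subset_Cyl[of \<delta> C n p f] \<Lambda>_le[of "R * \<delta>" p] \<delta> \<delta>\<^sub>0 C n unfolding R by simp
  qed
  ultimately show ?thesis by blast
qed

end
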